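(* Let $(G,+)$ be a divisible torsion-free abelian group and let $0\to\mathbb{Z}\xrightarrow{\iota}G\xrightarrow{\pi}\mathbb{R}/\mathbb{Z}\to 0$ be an exact sequence of groups, viewed as an $L$-structure $(G,\pi,\bar{\mathbb{R}})$. Then: (1) $(G,\pi,\bar{\mathbb{R}})\equiv((\mathbb{R},+),\mathrm{mod}_{\mathbb{Z}},\bar{\mathbb{R}})$ in $L$ if and only if for every positive integer $n$, $\pi(\iota(1_{\mathbb{Z}})/n)=\mathrm{mod}_{\mathbb{Z}}(1/n)$ (which is the element $1/n$ of the field sort under the identification $\mathbb{R}/\mathbb{Z}=[0,1)$). (2) The isomorphism type of the $L$-structure $(G,\pi,\bar{\mathbb{R}})$ is determined precisely by the image of the map $\hat\pi:G\to\widehat{\mathbb{R}/\mathbb{Z}}$, $x\mapsto(\pi(x/n))_{n\in\mathbb{N}^*}$ (two such structures are isomorphic iff these images coincide), and there are at least $2^{\aleph_0}$ possibilities. (3) $(G,\pi,\bar{\mathbb{R}})$ is isomorphic in $L$ to the standard model $((\mathbb{R},+),\mathrm{mod}_{\mathbb{Z}},\bar{\mathbb{R}})$ if and only if $(G,+)$ can be equipped with the structure of a topological group making $\pi$ a covering homomorphism.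
   Context: $\bar{\mathbb{R}}=(\mathbb{R},+,\cdot)$ is the real field, and $\mathbb{R}/\mathbb{Z}$ is identified with $[0,1)\subseteq\mathbb{R}$ with addition modulo $1$. $\mathrm{mod}_{\mathbb{Z}}:\mathbb{R}\to\mathbb{R}/\mathbb{Z}$ is the quotient map. The language $L$ has three sorts: a sort $\Gamma$ for the kernel (with its group structure) and a constant $1_{\mathbb{Z}}$ for a generator of it, a sort for $G$ with its group operation, and a field sort with the field structure of $\bar{\mathbb{R}}$; plus symbols for $\iota:\Gamma\to G$ and $\pi:G\to[0,1)$. For the given exact sequence, $\Gamma=\mathbb{Z}$ and $1_{\mathbb{Z}}$ is interpreted as $1$. The standard model $((\mathbb{R},+),\mathrm{mod}_{\mathbb{Z}},\bar{\mathbb{R}})$ has $G=\mathbb{R}$, $\iota$ the inclusion $\mathbb{Z}\subseteq\mathbb{R}$ and $\pi=\mathrm{mod}_{\mathbb{Z}}$. Since $G$ is divisible and torsion-free, $x/n$ denotes the unique $y\in G$ with $ny=x$. $\widehat{\mathbb{R}/\mathbb{Z}}$ is the inverse limit of the finite covers $\mathbb{R}/\mathbb{Z}\xrightarrow{k}\mathbb{R}/\mathbb{Z}$, i.e. the group of sequences $(h_i)_{i\in\mathbb{N}^*}$ in $\mathbb{R}/\mathbb{Z}$ with $k h_{ik}=h_i$ for all positive integers $i,k$. An $L$-isomorphism consists of isomorphisms of all sorts respecting all symbols (in particular it is the identity on the rigid field sort).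
   Formalization: Parts (2) and (3) hold only up to the sign of the generator named by 1_Z (G=R, π=mod_Z, ι(k)=-k is a counterexample), so isomorphism there allows 1_Z to name 1 or -1; the literal equivalences are proved for structures elementarily equivalent to the standard model. *)

theory Defs
  imports "HOL-Analysis.Analysis" "HOL-Algebra.Elementary_Groups" "HOL-Library.Equipollence"
begin

section \<open>The three-sorted language and its structures\<close>

text \<open>
  The language has a sort \<open>\<Gamma>\<close> with \<open>+\<close> and the constant \<open>1\<^sub>\<int>\<close>, a sort \<open>G\<close> with its operation, a
  field sort with \<open>+\<close> and \<open>\<cdot>\<close>, and the function symbols \<open>\<iota>\<close> and \<open>\<pi>\<close>.  The neutral elements,
  inverses and the constants \<open>0\<close> and \<open>1\<close> of the field are definable from these without parameters,
  so they are not given symbols.  The symbol \<open>\<pi>\<close> takes values in the field sort, as \<open>\<real>/\<int>\<close> is the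
  subset \<open>[0,1)\<close> of the field.
\<close>

record ('c, 'g, 'f) L_structure =
  Gam :: "'c set"
  gam_add :: "'c \<Rightarrow> 'c \<Rightarrow> 'c"
  gam_one :: 'c
  Grp :: "'g set"
  grp_add :: "'g \<Rightarrow> 'g \<Rightarrow> 'g"
  Fld :: "'f set"
  fld_add :: "'f \<Rightarrow> 'f \<Rightarrow> 'f"
  fld_mult :: "'f \<Rightarrow> 'f \<Rightarrow> 'f"
  incl :: "'c \<Rightarrow> 'g"
  proj :: "'g \<Rightarrow> 'f"

datatype sort = GamS | GrpS | FldS

datatype gam_tm = GamVar nat | GamOne | GamAdd gam_tm gam_tm
datatype grp_tm = GrpVar nat | GrpAdd grp_tm grp_tm | Incl gam_tm
datatype fld_tm = FldVar nat | FldAdd fld_tm fld_tm | FldMult fld_tm fld_tm | Proj grp_tm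

datatype L_form =
    GamEq gam_tm gam_tm
  | GrpEq grp_tm grp_tm
  | FldEq fld_tm fld_tm
  | Neg L_form
  | Conj L_form L_form
  | Forall sort nat L_form

primrec gam_val where
  "gam_val S u (GamVar i) = u i"
| "gam_val S u GamOne = gam_one S"
| "gam_val S u (GamAdd s t) = gam_add S (gam_val S u s) (gam_val S u t)"

primrec grp_val where
  "grp_val S u v (GrpVar i) = v i"
| "grp_val S u v (GrpAdd s t) = grp_add S (grp_val S u v s) (grp_val S u v t)"
| "grp_val S u v (Incl t) = incl S (gam_val S u t)"

primrec fld_val where
  "fld_val S u v w (FldVar i) = w i"
| "fld_val S u v w (FldAdd s t) = fld_add S (fld_val S u v w s) (fld_val S u v w t)"
| "fld_val S u v w (FldMult s t) = fld_mult S (fld_val S u v w s) (fld_val S u v w t)"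
| "fld_val S u v w (Proj t) = proj S (grp_val S u v t)"

primrec L_sat ::
  "('c, 'g, 'f) L_structure \<Rightarrow> (nat \<Rightarrow> 'c) \<Rightarrow> (nat \<Rightarrow> 'g) \<Rightarrow> (nat \<Rightarrow> 'f) \<Rightarrow> L_form \<Rightarrow> bool"
where
  "L_sat S u v w (GamEq s t) = (gam_val S u s = gam_val S u t)"
| "L_sat S u v w (GrpEq s t) = (grp_val S u v s = grp_val S u v t)"
| "L_sat S u v w (FldEq s t) = (fld_val S u v w s = fld_val S u v w t)"
| "L_sat S u v w (Neg \<phi>) = (\<not> L_sat S u v w \<phi>)"
| "L_sat S u v w (Conj \<phi> \<psi>) = (L_sat S u v w \<phi> \<and> L_sat S u v w \<psi>)"
| "L_sat S u v w (Forall a i \<phi>) =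
    (case a of
       GamS \<Rightarrow> \<forall>x \<in> Gam S. L_sat S (u(i := x)) v w \<phi>
     | GrpS \<Rightarrow> \<forall>x \<in> Grp S. L_sat S u (v(i := x)) w \<phi>
     | FldS \<Rightarrow> \<forall>x \<in> Fld S. L_sat S u v (w(i := x)) \<phi>)"

primrec gam_vars :: "gam_tm \<Rightarrow> (sort \<times> nat) set" where
  "gam_vars (GamVar i) = {(GamS, i)}"
| "gam_vars GamOne = {}"
| "gam_vars (GamAdd s t) = gam_vars s \<union> gam_vars t"

primrec grp_vars :: "grp_tm \<Rightarrow> (sort \<times> nat) set" where
  "grp_vars (GrpVar i) = {(GrpS, i)}"
| "grp_vars (GrpAdd s t) = grp_vars s \<union> grp_vars t"
| "grp_vars (Incl t) = gam_vars t"

primrec fld_vars :: "fld_tm \<Rightarrow> (sort \<times> nat) set" where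
  "fld_vars (FldVar i) = {(FldS, i)}"
| "fld_vars (FldAdd s t) = fld_vars s \<union> fld_vars t"
| "fld_vars (FldMult s t) = fld_vars s \<union> fld_vars t"
| "fld_vars (Proj t) = grp_vars t"

primrec free_vars :: "L_form \<Rightarrow> (sort \<times> nat) set" where
  "free_vars (GamEq s t) = gam_vars s \<union> gam_vars t"
| "free_vars (GrpEq s t) = grp_vars s \<union> grp_vars t"
| "free_vars (FldEq s t) = fld_vars s \<union> fld_vars t"
| "free_vars (Neg \<phi>) = free_vars \<phi>"
| "free_vars (Conj \<phi> \<psi>) = free_vars \<phi> \<union> free_vars \<psi>"
| "free_vars (Forall a i \<phi>) = free_vars \<phi> - {(a, i)}"

definition L_models :: "('c, 'g, 'f) L_structure \<Rightarrow> L_form \<Rightarrow> bool" where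
  "L_models S \<phi> \<longleftrightarrow>
    (\<forall>u v w. range u \<subseteq> Gam S \<and> range v \<subseteq> Grp S \<and> range w \<subseteq> Fld S \<longrightarrow> L_sat S u v w \<phi>)"

definition elem_equiv ::
  "('c, 'g, 'f) L_structure \<Rightarrow> ('c2, 'g2, 'f2) L_structure \<Rightarrow> bool" (infix \<open>\<equiv>\<^sub>L\<close> 50)
where
  "S \<equiv>\<^sub>L S' \<longleftrightarrow> (\<forall>\<phi>. free_vars \<phi> = {} \<longrightarrow> (L_models S \<phi> \<longleftrightarrow> L_models S' \<phi>))"

definition L_isomorphic ::
  "('c, 'g, 'f) L_structure \<Rightarrow> ('c2, 'g2, 'f2) L_structure \<Rightarrow> bool" (infix \<open>\<cong>\<^sub>L\<close> 50)
where
  "S \<cong>\<^sub>L S' \<longleftrightarrow> (\<exists>a b c.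
      bij_betw a (Gam S) (Gam S') \<and> bij_betw b (Grp S) (Grp S') \<and> bij_betw c (Fld S) (Fld S') \<and>
      (\<forall>x \<in> Gam S. \<forall>y \<in> Gam S. a (gam_add S x y) = gam_add S' (a x) (a y)) \<and>
      a (gam_one S) = gam_one S' \<and>
      (\<forall>x \<in> Grp S. \<forall>y \<in> Grp S. b (grp_add S x y) = grp_add S' (b x) (b y)) \<and>
      (\<forall>x \<in> Fld S. \<forall>y \<in> Fld S. c (fld_add S x y) = fld_add S' (c x) (c y)) \<and>
      (\<forall>x \<in> Fld S. \<forall>y \<in> Fld S. c (fld_mult S x y) = fld_mult S' (c x) (c y)) \<and>
      (\<forall>x \<in> Gam S. b (incl S x) = incl S' (a x)) \<and>
      (\<forall>x \<in> Grp S. c (proj S x) = proj S' (b x)))"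

text \<open>
  Isomorphism for a suitable choice of the generator of \<open>\<Gamma> = \<int>\<close> named by \<open>1\<^sub>\<int>\<close> in the second
  structure.  Exactness of a sequence does not determine the sign of that generator.
\<close>

definition L_isomorphic_gen ::
  "('c, 'g, 'f) L_structure \<Rightarrow> (int, 'g2, 'f2) L_structure \<Rightarrow> bool" (infix \<open>\<cong>\<^sub>\<plusminus>\<close> 50)
where
  "S \<cong>\<^sub>\<plusminus> S' \<longleftrightarrow> (\<exists>e \<in> {1, -1}. S \<cong>\<^sub>L S'\<lparr>gam_one := e\<rparr>)"


section \<open>Extensions of the circle group by the integers\<close>

definition RZ :: "real monoid" where
  "RZ = \<lparr>carrier = {0..<1}, mult = (\<lambda>x y. frac (x + y)), one = 0\<rparr>"

definition real_add_group :: "real monoid" where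
  "real_add_group = \<lparr>carrier = UNIV, mult = (+), one = 0\<rparr>"

text \<open>Groups are written multiplicatively in the library: \<open>x [^] n\<close> is the multiple \<open>n x\<close>.\<close>

definition divisible_group :: "('g, 'm) monoid_scheme \<Rightarrow> bool" where
  "divisible_group G \<longleftrightarrow>
    (\<forall>x \<in> carrier G. \<forall>n::nat. n \<ge> 1 \<longrightarrow> (\<exists>y \<in> carrier G. y [^]\<^bsub>G\<^esub> n = x))"

definition torsion_free_group :: "('g, 'm) monoid_scheme \<Rightarrow> bool" where
  "torsion_free_group G \<longleftrightarrow>
    (\<forall>x \<in> carrier G. \<forall>n::nat. n \<ge> 1 \<longrightarrow> x [^]\<^bsub>G\<^esub> n = \<one>\<^bsub>G\<^esub> \<longrightarrow> x = \<one>\<^bsub>G\<^esub>)"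

definition gdiv :: "('g, 'm) monoid_scheme \<Rightarrow> 'g \<Rightarrow> nat \<Rightarrow> 'g" where
  "gdiv G x n = (THE y. y \<in> carrier G \<and> y [^]\<^bsub>G\<^esub> n = x)"

definition RZ_extension :: "'g monoid \<Rightarrow> (int \<Rightarrow> 'g) \<Rightarrow> ('g \<Rightarrow> real) \<Rightarrow> bool" where
  "RZ_extension G \<iota> \<pi> \<longleftrightarrow>
    comm_group G \<and> divisible_group G \<and> torsion_free_group G \<and>
    \<iota> \<in> mon integer_group G \<and> \<pi> \<in> epi G RZ \<and> kernel G RZ \<pi> = \<iota> ` carrier integer_group"

definition ext_structure ::
  "'g monoid \<Rightarrow> (int \<Rightarrow> 'g) \<Rightarrow> ('g \<Rightarrow> real) \<Rightarrow> (int, 'g, real) L_structure"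
where
  "ext_structure G \<iota> \<pi> =
    \<lparr>Gam = UNIV, gam_add = (+), gam_one = 1,
     Grp = carrier G, grp_add = (\<lambda>x y. x \<otimes>\<^bsub>G\<^esub> y),
     Fld = UNIV, fld_add = (+), fld_mult = (*),
     incl = \<iota>, proj = \<pi>\<rparr>"

definition RZ_structures :: "(int, 'g, real) L_structure set" where
  "RZ_structures = {ext_structure G \<iota> \<pi> | G \<iota> \<pi>. RZ_extension G \<iota> \<pi>}"

definition standard_model :: "(int, real, real) L_structure" where
  "standard_model = ext_structure real_add_group of_int frac"


section \<open>The inverse limit of the finite covers of the circle\<close>

definition RZ_hat :: "(nat \<Rightarrow> real) monoid" where
  "RZ_hat =
    \<lparr>carrier = {h \<in> {1..} \<rightarrow>\<^sub>E carrier RZ. \<forall>i\<ge>1. \<forall>k\<ge>1. h (i * k) [^]\<^bsub>RZ\<^esub> k = h i},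
     mult = (\<lambda>h h'. \<lambda>i\<in>{1..}. h i \<otimes>\<^bsub>RZ\<^esub> h' i),
     one = (\<lambda>i\<in>{1..}. \<one>\<^bsub>RZ\<^esub>)\<rparr>"

definition pi_hat :: "'g monoid \<Rightarrow> ('g \<Rightarrow> real) \<Rightarrow> 'g \<Rightarrow> (nat \<Rightarrow> real)" where
  "pi_hat G \<pi> x = (\<lambda>n\<in>{1..}. \<pi> (gdiv G x n))"


section \<open>Topological groups and coverings\<close>

definition RZ_topology :: "real topology" where
  "RZ_topology = topology (\<lambda>U. U \<subseteq> carrier RZ \<and> open {x. frac x \<in> U})"

text \<open>The library's \<^const>\<open>covering_space\<close>, for abstract topologies.\<close>

definition covering_map :: "'a topology \<Rightarrow> 'b topology \<Rightarrow> ('a \<Rightarrow> 'b) \<Rightarrow> bool" where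
  "covering_map X Y p \<longleftrightarrow>
    continuous_map X Y p \<and> p ` topspace X = topspace Y \<and>
    (\<forall>y \<in> topspace Y. \<exists>T. y \<in> T \<and> openin Y T \<and>
      (\<exists>V. \<Union>V = topspace X \<inter> p -` T \<and>
           (\<forall>U \<in> V. openin X U) \<and> pairwise disjnt V \<and>
           (\<forall>U \<in> V. homeomorphic_map (subtopology X U) (subtopology Y T) p)))"

definition topological_group :: "'g monoid \<Rightarrow> 'g topology \<Rightarrow> bool" where
  "topological_group G X \<longleftrightarrow>
    group G \<and> topspace X = carrier G \<and>
    continuous_map (prod_topology X X) X (\<lambda>(x, y). x \<otimes>\<^bsub>G\<^esub> y) \<and>
    continuous_map X X (\<lambda>x. inv\<^bsub>G\<^esub> x)"


section \<open>Basic facts\<close>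

lemma openin_RZ_topology:
  "openin RZ_topology U \<longleftrightarrow> U \<subseteq> carrier RZ \<and> open {x. frac x \<in> U}"
proof -
  have "istopology (\<lambda>U. U \<subseteq> carrier RZ \<and> open {x::real. frac x \<in> U})"
    unfolding istopology_def
  proof (intro conjI allI impI)
    fix S T
    assume "S \<subseteq> carrier RZ \<and> open {x::real. frac x \<in> S}" "T \<subseteq> carrier RZ \<and> open {x::real. frac x \<in> T}"
    then show "S \<inter> T \<subseteq> carrier RZ" "open {x::real. frac x \<in> S \<inter> T}"
      by (auto simp: Collect_conj_eq)
  next
    fix \<K>
    assume K: "\<forall>K\<in>\<K>. K \<subseteq> carrier RZ \<and> open {x::real. frac x \<in> K}"
    then show "\<Union>\<K> \<subseteq> carrier RZ"
      by auto
    have "{x::real. frac x \<in> \<Union>\<K>} = (\<Union>K\<in>\<K>. {x. frac x \<in> K})"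
      by auto
    then show "open {x::real. frac x \<in> \<Union>\<K>}"
      using K by auto
  qed
  then show ?thesis
    by (simp add: RZ_topology_def)
qed

lemma topspace_RZ_topology: "topspace RZ_topology = carrier RZ"
proof -
  have "{x::real. frac x \<in> carrier RZ} = UNIV"
    by (auto simp: RZ_def frac_lt_1)
  then have "openin RZ_topology (carrier RZ)"
    by (simp add: openin_RZ_topology)
  then show ?thesis
    by (metis openin_RZ_topology openin_subset openin_topspace subset_antisym)
qed

lemma quotient_map_frac: "quotient_map euclideanreal RZ_topology frac"
proof -
  have "range (frac :: real \<Rightarrow> real) = carrier RZ"
  proof
    show "range (frac :: real \<Rightarrow> real) \<subseteq> carrier RZ"
      by (auto simp: RZ_def frac_lt_1)
    show "carrier RZ \<subseteq> range (frac :: real \<Rightarrow> real)"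
    proof
      fix x assume "x \<in> carrier RZ"
      then have "frac x = x"
        by (simp add: RZ_def frac_eq)
      then show "x \<in> range (frac :: real \<Rightarrow> real)"
        by (metis rangeI)
    qed
  qed
  then show ?thesis
    by (auto simp: quotient_map_def topspace_RZ_topology openin_RZ_topology)
qed

lemma frac_add_of_int: "frac (x + of_int k) = frac x" for x :: real
  by (simp add: frac_def)

lemma comm_group_RZ: "comm_group RZ"
proof (rule comm_groupI)
  fix x y z assume "x \<in> carrier RZ" "y \<in> carrier RZ" "z \<in> carrier RZ"
  have fr: "frac (frac a + b) = frac (a + b)" for a b :: real
  proof -
    have "frac a + b = a + b + of_int (- \<lfloor>a\<rfloor>)"
      by (simp add: frac_def)
    then show ?thesis
      by (simp only: frac_add_of_int)
  qed
  have "frac (frac (x + y) + z) = frac (x + frac (y + z))"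
    using fr[of "x + y" z] fr[of "y + z" x] by (simp add: ac_simps)
  then show "x \<otimes>\<^bsub>RZ\<^esub> y \<otimes>\<^bsub>RZ\<^esub> z = x \<otimes>\<^bsub>RZ\<^esub> (y \<otimes>\<^bsub>RZ\<^esub> z)"
    by (simp add: RZ_def)
next
  fix x assume x: "x \<in> carrier RZ"
  show "\<exists>y\<in>carrier RZ. y \<otimes>\<^bsub>RZ\<^esub> x = \<one>\<^bsub>RZ\<^esub>"
  proof (cases "x = 0")
    case False
    with x show ?thesis
      by (intro bexI[of _ "1 - x"]) (auto simp: RZ_def)
  qed (use x in \<open>auto simp: RZ_def\<close>)
qed (auto simp: RZ_def frac_lt_1 frac_eq add.commute)

lemma gdiv_unique:
  assumes "comm_group G" "torsion_free_group G" "n \<ge> 1" "y \<in> carrier G" "y [^]\<^bsub>G\<^esub> n = x"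
  shows "gdiv G x n = y"
  unfolding gdiv_def
proof (rule the_equality)
  fix z assume z: "z \<in> carrier G \<and> z [^]\<^bsub>G\<^esub> n = x"
  interpret comm_group G by fact
  have "(z \<otimes>\<^bsub>G\<^esub> inv\<^bsub>G\<^esub> y) [^]\<^bsub>G\<^esub> n = \<one>\<^bsub>G\<^esub>"
    using z assms by (auto simp: pow_mult_distrib[OF m_comm] nat_pow_inv)
  then have "z \<otimes>\<^bsub>G\<^esub> inv\<^bsub>G\<^esub> y = \<one>\<^bsub>G\<^esub>"
    using z assms by (auto simp: torsion_free_group_def)
  then show "z = y"
    using z assms(4) by (metis inv_closed inv_equality inv_inv)
qed (use assms in auto)

lemma gdiv_pow:
  assumes "comm_group G" "divisible_group G" "torsion_free_group G" "n \<ge> 1" "x \<in> carrier G"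
  shows "gdiv G x n \<in> carrier G" "gdiv G x n [^]\<^bsub>G\<^esub> n = x"
proof -
  obtain y where "y \<in> carrier G" "y [^]\<^bsub>G\<^esub> n = x"
    using assms by (auto simp: divisible_group_def)
  then show "gdiv G x n \<in> carrier G" "gdiv G x n [^]\<^bsub>G\<^esub> n = x"
    using gdiv_unique assms by metis+
qed

lemma pi_hat_hom:
  assumes "RZ_extension G \<iota> \<pi>"
  shows "pi_hat G \<pi> \<in> hom G RZ_hat"
proof -
  from assms have G: "comm_group G" "divisible_group G" "torsion_free_group G"
    and hom: "\<pi> \<in> hom G RZ"
    by (auto simp: RZ_extension_def epi_def)
  interpret G: comm_group G by fact
  interpret RZ: comm_group RZ by (rule comm_group_RZ)
  interpret group_hom G RZ \<pi>
    using hom by unfold_locales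
  show ?thesis
  proof (rule homI)
    fix x assume x: "x \<in> carrier G"
    have "\<pi> (gdiv G x (i * k)) [^]\<^bsub>RZ\<^esub> k = \<pi> (gdiv G x i)" if "i \<ge> 1" "k \<ge> 1" for i k :: nat
    proof -
      have ik: "i * k \<ge> 1" using that by simp
      note d = gdiv_pow[OF G ik x]
      have "gdiv G x i = gdiv G x (i * k) [^]\<^bsub>G\<^esub> k"
        by (rule gdiv_unique[OF G(1,3) that(1)])
          (use d in \<open>auto simp: G.nat_pow_pow mult.commute\<close>)
      then show ?thesis
        using d by (simp add: hom_nat_pow)
    qed
    then show "pi_hat G \<pi> x \<in> carrier RZ_hat"
      using gdiv_pow(1)[OF G _ x] by (auto simp: RZ_hat_def pi_hat_def)
  next
    fix x y assume xy: "x \<in> carrier G" "y \<in> carrier G"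
    have "gdiv G (x \<otimes>\<^bsub>G\<^esub> y) n = gdiv G x n \<otimes>\<^bsub>G\<^esub> gdiv G y n" if "n \<ge> 1" for n
      by (rule gdiv_unique[OF G(1,3) that])
        (use gdiv_pow[OF G that] xy in \<open>auto simp: G.pow_mult_distrib[OF G.m_comm]\<close>)
    then show "pi_hat G \<pi> (x \<otimes>\<^bsub>G\<^esub> y) = pi_hat G \<pi> x \<otimes>\<^bsub>RZ_hat\<^esub> pi_hat G \<pi> y"
      using gdiv_pow(1)[OF G _ xy(1)] gdiv_pow(1)[OF G _ xy(2)]
      by (auto simp: RZ_hat_def pi_hat_def fun_eq_iff)
  qed
qed

text \<open>
  The sign of \<open>1\<^sub>\<int>\<close> is visible to \<open>\<cong>\<^sub>L\<close> but not to the group \<open>G\<close> with its map \<open>\<pi>\<close>: on the same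
  \<open>G = \<real>\<close> and \<open>\<pi> = mod\<^sub>\<int>\<close> the two inclusions \<open>k \<mapsto> k\<close> and \<open>k \<mapsto> -k\<close> both give exact sequences, and the
  resulting structures are not isomorphic.
\<close>

lemma real_add_group_pow: "x [^]\<^bsub>real_add_group\<^esub> (n::nat) = of_nat n * x"
  by (induction n) (simp_all add: real_add_group_def nat_pow_def algebra_simps)

lemma RZ_extension_real:
  fixes e :: int
  assumes "e \<in> {1, -1}"
  shows "RZ_extension real_add_group (\<lambda>k. of_int (e * k)) frac"
proof -
  have cg: "comm_group real_add_group"
    by (rule comm_groupI) (auto simp: real_add_group_def intro: exI[of _ "- _"])
  have dv: "divisible_group real_add_group"
    unfolding divisible_group_def real_add_group_pow
  proof (intro ballI allI impI)
    fix x and n :: nat assume "n \<ge> 1"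
    then show "\<exists>y \<in> carrier real_add_group. real n * y = x"
      by (intro bexI[of _ "x / real n"]) (auto simp: real_add_group_def)
  qed
  have tf: "torsion_free_group real_add_group"
    unfolding torsion_free_group_def real_add_group_pow by (auto simp: real_add_group_def)
  have mn: "(\<lambda>k. of_int (e * k)) \<in> mon integer_group real_add_group"
    using assms by (auto simp: mon_def hom_def inj_on_def real_add_group_def integer_group_def)
  have "frac (a + b) = frac (frac a + frac b)" for a b :: real
  proof -
    have "frac a + frac b = a + b + of_int (- \<lfloor>a\<rfloor> - \<lfloor>b\<rfloor>)"
      by (simp add: frac_def)
    then show ?thesis
      by (simp only: frac_add_of_int)
  qed
  moreover have "range (frac :: real \<Rightarrow> real) = carrier RZ"
    using quotient_map_frac by (simp add: quotient_map_def topspace_RZ_topology)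
  ultimately have ep: "frac \<in> epi real_add_group RZ"
    by (auto simp: epi_def hom_def real_add_group_def RZ_def frac_lt_1)
  have "frac x = 0 \<longleftrightarrow> x \<in> range (\<lambda>k. of_int (e * k))" for x :: real
  proof
    assume "frac x = 0"
    then obtain k where "x = of_int k"
      by (auto simp: frac_eq_0_iff elim: Ints_cases)
    then show "x \<in> range (\<lambda>k. of_int (e * k))"
      using assms by (intro image_eqI[of _ _ "e * k"]) auto
  qed auto
  then have "kernel real_add_group RZ frac = (\<lambda>k. of_int (e * k)) ` carrier integer_group"
    by (auto simp: kernel_def real_add_group_def RZ_def integer_group_def)
  with cg dv tf mn ep show ?thesis
    by (simp add: RZ_extension_def)
qed

lemma not_isomorphic_opposite_sign:
  "\<not> ext_structure real_add_group (\<lambda>k. of_int (- k)) frac \<cong>\<^sub>L standard_model"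
proof
  assume "ext_structure real_add_group (\<lambda>k. of_int (- k)) frac \<cong>\<^sub>L standard_model"
  then obtain a :: "int \<Rightarrow> int" and b c :: "real \<Rightarrow> real" where
    bij: "bij c" and a1: "a 1 = 1" and
    b: "\<And>x y. b (x + y) = b x + b y" and
    c: "\<And>x y. c (x + y) = c x + c y" and m: "\<And>x y. c (x * y) = c x * c y" and
    ba: "\<And>x. b (of_int (- x)) = of_int (a x)" and cb: "\<And>x. c (frac x) = frac (b x)"
    unfolding L_isomorphic_def standard_model_def ext_structure_def real_add_group_def
    by auto
  have c0: "c 0 = 0" using c[of 0 0] by simp
  then have "c 1 \<noteq> 0"
    using bij by (metis bij_pointE zero_neq_one)
  then have c1: "c 1 = 1" using m[of 1 1] by simp
  have "c 1 = 3 * c (1/3)"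
    using c[of "1/3" "1/3"] c[of "2/3" "1/3"] by simp
  then have c3: "c (1/3) = 1/3" using c1 by simp
  have b0: "b 0 = 0" using b[of 0 0] by simp
  have "b 1 = 3 * b (1/3)"
    using b[of "1/3" "1/3"] b[of "2/3" "1/3"] by simp
  moreover have "b 1 = - 1"
    using ba[of 1] a1 b[of 1 "-1"] b0 by simp
  ultimately have "b (1/3) = - (1/3)" by simp
  moreover have "frac (- (1/3) :: real) = 2/3"
    using frac_add_of_int[of "- (1/3)" 1] by (simp add: frac_eq)
  moreover have "frac (1/3 :: real) = 1/3"
    by (simp add: frac_eq)
  ultimately show False
    using cb[of "1/3"] c3 by simp
qed

end

theory Submission
  imports Defs
begin

text \<open>
  Elementary equivalence is an Ehrenfeucht-Fraisse game in which the integers and the reals are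
  matched identically. Tuples of the two groups are matched when \<open>\<pi>(x\<^sub>i/D)\<close> agree and all integral
  relations \<open>\<Sum>a\<^sub>i x\<^sub>i = \<iota>(k)\<close> of bounded weight agree. A new element that satisfies no short relation
  over the tuple can be answered by any lift of its image under \<open>\<pi>\<close>, because relations modulo the
  kernel are visible under \<open>\<pi>\<close>; one that does is answered by solving the same relation, at the cost
  of a larger bound and a larger \<open>D\<close>. The torsion condition handles the division of \<open>\<iota>(k)\<close>.

  The map \<open>x \<mapsto> (\<pi>(x/n))\<^sub>n\<close> is injective, since no nonzero integer is divisible by all positive integers,
  and the field automorphisms of the reals are trivial; so isomorphisms are comparisons of images.
  For continuum many types, \<open>mod\<^sub>\<int>\<close> is twisted by a rational functional followed by multiplication with
  a profinite integer \<open>\<Sum>j\<in>A. j!\<close>, whose class modulo \<open>\<int>\<close> can be recovered from the image.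

  For a covering homomorphism, a local section near \<open>0\<close> is additive and hence commutes with division
  by \<open>n\<close>, so the image contains that of the standard model, and inclusion of images forces equality.
\<close>

section \<open>Division in extensions of the circle\<close>

locale rz_extension =
  fixes G :: "'g monoid" (structure) and \<iota> :: "int \<Rightarrow> 'g" and \<pi> :: "'g \<Rightarrow> real"
  assumes ext: "RZ_extension G \<iota> \<pi>"

sublocale rz_extension \<subseteq> comm_group G
  using ext by (simp add: RZ_extension_def)

sublocale rz_extension \<subseteq> \<pi>: group_hom G RZ \<pi>
  using ext comm_group_RZ
  by (intro group_hom.intro group_hom_axioms.intro)
    (auto simp: RZ_extension_def epi_def comm_group_def)

sublocale rz_extension \<subseteq> \<iota>: group_hom integer_group G \<iota>
  using ext by (intro group_hom.intro group_hom_axioms.intro)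
    (auto simp: RZ_extension_def mon_def comm_group_def)

context rz_extension
begin

lemma divisible: "divisible_group G" and torsion_free: "torsion_free_group G"
  using ext by (auto simp: RZ_extension_def)

lemmas gdiv_unique = gdiv_unique[OF comm_group_axioms torsion_free]
lemmas gdiv_closed [intro, simp] = gdiv_pow(1)[OF comm_group_axioms divisible torsion_free]
lemmas gdiv_power = gdiv_pow(2)[OF comm_group_axioms divisible torsion_free]

lemma incl_closed [intro, simp]: "\<iota> k \<in> carrier G"
  using \<iota>.hom_closed[of k] by simp

lemma incl_add: "\<iota> (j + k) = \<iota> j \<otimes> \<iota> k"
  using \<iota>.hom_mult[of j k] by simp

lemma incl_0 [simp]: "\<iota> 0 = \<one>"
  using \<iota>.hom_one by simp

lemma incl_int_pow: "\<iota> k [^] (m::int) = \<iota> (m * k)"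
  using \<iota>.hom_int_pow[of k m] by simp

lemma incl_nat_pow: "\<iota> k [^] (m::nat) = \<iota> (int m * k)"
  using incl_int_pow[of k "int m"] by (simp add: int_pow_int)

lemma incl_uminus: "\<iota> (- k) = inv (\<iota> k)"
  using \<iota>.hom_inv[of k] by simp

lemma incl_eq_iff [simp]: "\<iota> j = \<iota> k \<longleftrightarrow> j = k"
  using ext by (auto simp: RZ_extension_def mon_def inj_on_def)

lemma incl_eq_one_iff [simp]: "\<iota> k = \<one> \<longleftrightarrow> k = 0"
  using incl_eq_iff[of k 0] by simp

lemma pi_eq_0_iff:
  assumes "x \<in> carrier G"
  shows "\<pi> x = 0 \<longleftrightarrow> x \<in> range \<iota>"
proof -
  have "kernel G RZ \<pi> = range \<iota>"
    using ext by (simp add: RZ_extension_def)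
  then show ?thesis
    using assms by (auto simp: kernel_def RZ_def)
qed

lemma pi_incl [simp]: "\<pi> (\<iota> k) = 0"
  by (simp add: pi_eq_0_iff)

lemma pi_surj:
  assumes "t \<in> carrier RZ"
  obtains x where "x \<in> carrier G" "\<pi> x = t"
proof -
  have "t \<in> \<pi> ` carrier G"
    using ext assms by (simp add: RZ_extension_def epi_def)
  then show thesis
    using that by (elim imageE) simp
qed

lemma nat_pow_cancel:
  assumes "x \<in> carrier G" "y \<in> carrier G" "n \<ge> 1" "x [^] (n::nat) = y [^] n"
  shows "x = y"
  using gdiv_unique[of n x] gdiv_unique[of n y] assms by metis

lemma gdiv_1 [simp]: "x \<in> carrier G \<Longrightarrow> gdiv G x (Suc 0) = x"
  by (rule gdiv_unique) auto

lemma gdiv_one [simp]: "n \<ge> 1 \<Longrightarrow> gdiv G \<one> n = \<one>"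
  by (rule gdiv_unique) auto

lemma gdiv_mult:
  assumes "x \<in> carrier G" "y \<in> carrier G" "n \<ge> 1"
  shows "gdiv G (x \<otimes> y) n = gdiv G x n \<otimes> gdiv G y n"
  using assms by (intro gdiv_unique) (auto simp: pow_mult_distrib[OF m_comm] gdiv_power)

lemma gdiv_inv:
  assumes "x \<in> carrier G" "n \<ge> 1"
  shows "gdiv G (inv x) n = inv (gdiv G x n)"
  using assms by (intro gdiv_unique) (auto simp: nat_pow_inv gdiv_power)

lemma gdiv_int_pow:
  assumes "x \<in> carrier G" "n \<ge> 1"
  shows "gdiv G (x [^] (m::int)) n = gdiv G x n [^] m"
proof (rule gdiv_unique)
  have "(gdiv G x n [^] m) [^] int n = (gdiv G x n [^] int n) [^] m"
    using assms by (simp add: int_pow_pow mult.commute)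
  then show "(gdiv G x n [^] m) [^] n = x [^] m"
    using assms by (simp add: int_pow_int gdiv_power)
qed (use assms in auto)

lemma gdiv_gdiv:
  assumes "x \<in> carrier G" "m \<ge> 1" "n \<ge> 1"
  shows "gdiv G (gdiv G x m) n = gdiv G x (m * n)"
proof (rule gdiv_unique)
  have mn: "m * n \<ge> 1"
    using assms by simp
  have "(gdiv G x (m * n) [^] n) [^] m = x"
    using assms gdiv_power[OF mn, of x] gdiv_closed[OF mn, of x]
    by (simp add: nat_pow_pow mult.commute)
  then show "gdiv G x (m * n) [^] n = gdiv G x m"
    using assms gdiv_closed[OF mn, of x] by (intro gdiv_unique[symmetric]) auto
  show "gdiv G x (m * n) \<in> carrier G"
    using assms gdiv_closed[OF mn, of x] by simp
qed (use assms in auto)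

end

section \<open>The circle group and the real line as an extension of it\<close>

interpretation RZ: comm_group RZ
  by (rule comm_group_RZ)

lemma RZ_mult: "x \<otimes>\<^bsub>RZ\<^esub> y = frac (x + y)" and RZ_one [simp]: "\<one>\<^bsub>RZ\<^esub> = 0"
  by (simp_all add: RZ_def)

lemma in_carrier_RZ: "x \<in> carrier RZ \<longleftrightarrow> 0 \<le> x \<and> x < 1"
  by (simp add: RZ_def)

lemma rz_extension_real: "rz_extension real_add_group of_int frac"
  using RZ_extension_real[of 1] by unfold_locales simp

lemma gdiv_real: "n \<ge> 1 \<Longrightarrow> gdiv real_add_group x n = x / real n"
proof -
  interpret rz_extension real_add_group of_int frac
    by (rule rz_extension_real)
  assume "n \<ge> 1"
  then show ?thesis
    by (intro gdiv_unique) (simp_all add: real_add_group_pow, simp add: real_add_group_def)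
qed

section \<open>Integral relations and the back-and-forth invariant\<close>

text \<open>A variable may be listed several times, so that adding forms is concatenation and no
  normal form has to be maintained.\<close>

type_synonym lin_form = "(nat \<times> int) list"

primrec lincomb :: "('g, 'm) monoid_scheme \<Rightarrow> (nat \<Rightarrow> 'g) \<Rightarrow> lin_form \<Rightarrow> 'g" where
  "lincomb G v [] = \<one>\<^bsub>G\<^esub>"
| "lincomb G v (p # l) = v (fst p) [^]\<^bsub>G\<^esub> snd p \<otimes>\<^bsub>G\<^esub> lincomb G v l"

text \<open>This is the l1 norm taken before repeated variables are merged, hence additive under
  concatenation.\<close>

definition weight :: "lin_form \<Rightarrow> nat" where
  "weight l = (\<Sum>p\<leftarrow>l. nat \<bar>snd p\<bar>)"

definition scale_form :: "int \<Rightarrow> lin_form \<Rightarrow> lin_form" where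
  "scale_form m l = map (\<lambda>p. (fst p, m * snd p)) l"

definition coef :: "nat \<Rightarrow> lin_form \<Rightarrow> int" where
  "coef j l = (\<Sum>p\<leftarrow>l. if fst p = j then snd p else 0)"

definition drop_var :: "nat \<Rightarrow> lin_form \<Rightarrow> lin_form" where
  "drop_var j l = filter (\<lambda>p. fst p \<noteq> j) l"

lemma weight_append: "weight (l @ l') = weight l + weight l'"
  by (simp add: weight_def)

lemma weight_scale_form: "weight (scale_form m l) = nat \<bar>m\<bar> * weight l"
  by (induction l) (auto simp: weight_def scale_form_def abs_mult nat_mult_distrib algebra_simps)

text \<open>This is the triangle inequality. It keeps both the coefficient to be eliminated and the
  remaining form below the bound on the whole form.\<close>

lemma weight_drop_var: "nat \<bar>coef j l\<bar> + weight (drop_var j l) \<le> weight l"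
  by (induction l) (auto simp: weight_def coef_def drop_var_def)

context comm_group
begin

lemma lincomb_closed [intro, simp]: "(\<And>i. v i \<in> carrier G) \<Longrightarrow> lincomb G v l \<in> carrier G"
  by (induction l) auto

lemma lincomb_append:
  assumes "\<And>i. v i \<in> carrier G"
  shows "lincomb G v (l @ l') = lincomb G v l \<otimes> lincomb G v l'"
  by (induction l) (simp_all add: assms m_assoc)

lemma lincomb_scale_form:
  assumes "\<And>i. v i \<in> carrier G"
  shows "lincomb G v (scale_form m l) = lincomb G v l [^] m"
  by (induction l) (simp_all add: scale_form_def assms int_pow_distrib int_pow_pow mult.commute)

text \<open>It separates the element chosen at a group quantifier from the entries chosen
  before.\<close>

lemma lincomb_upd:
  assumes "\<And>i. v i \<in> carrier G" "g \<in> carrier G"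
  shows "lincomb G (v(j := g)) l = g [^] coef j l \<otimes> lincomb G v (drop_var j l)"
proof (induction l)
  case Nil
  then show ?case by (simp add: coef_def drop_var_def)
next
  case (Cons p l)
  show ?case
  proof (cases "fst p = j")
    case True
    then have "coef j (p # l) = snd p + coef j l" "drop_var j (p # l) = drop_var j l"
      by (simp_all add: coef_def drop_var_def)
    then show ?thesis
      using Cons True assms by (simp add: int_pow_mult m_assoc)
  next
    case False
    then have "coef j (p # l) = coef j l" "drop_var j (p # l) = p # drop_var j l"
      by (simp_all add: coef_def drop_var_def)
    then show ?thesis
      using Cons False assms by (simp add: m_lcomm)
  qed
qed

end

lemma (in group_hom) hom_lincomb:
  assumes "comm_group G" "\<And>i. v i \<in> carrier G"
  shows "h (lincomb G v l) = lincomb H (\<lambda>i. h (v i)) l"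
proof (induction l)
  case (Cons p l)
  then show ?case
    using assms by (simp add: hom_int_pow comm_group.lincomb_closed)
qed simp

lemma (in rz_extension) gdiv_lincomb:
  assumes "\<And>i. v i \<in> carrier G" "n \<ge> 1"
  shows "gdiv G (lincomb G v l) n = lincomb G (\<lambda>i. gdiv G (v i) n) l"
  using assms by (induction l) (simp_all add: gdiv_mult gdiv_int_pow)

section \<open>Matched tuples in two extensions with the same torsion data\<close>

locale rz_extension_pair =
  G: rz_extension G \<iota> \<pi> + H: rz_extension H \<kappa> \<rho>
  for G :: "'g monoid" and \<iota> \<pi> and H :: "'h monoid" and \<kappa> \<rho> +
  assumes same_torsion: "n \<ge> 1 \<Longrightarrow> \<pi> (gdiv G (\<iota> 1) n) = \<rho> (gdiv H (\<kappa> 1) n)"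
begin

text \<open>Tuples are total assignments, as in the semantics of formulas. Relations are transferred
  from \<open>G\<close> to \<open>H\<close> only; comparing projections gives the converse.\<close>

definition similar :: "nat \<Rightarrow> nat \<Rightarrow> (nat \<Rightarrow> 'g) \<Rightarrow> (nat \<Rightarrow> 'h) \<Rightarrow> bool" where
  "similar N D x y \<longleftrightarrow>
     (\<forall>i. x i \<in> carrier G \<and> y i \<in> carrier H \<and> \<pi> (gdiv G (x i) D) = \<rho> (gdiv H (y i) D)) \<and>
     (\<forall>l k. weight l \<le> N \<and> lincomb G x l = \<iota> k \<longrightarrow> lincomb H y l = \<kappa> k)"

text \<open>If \<open>D' = D * E\<close>, then \<open>x/D\<close> is \<open>E\<close> times
  \<open>x/D'\<close>, so its projection is determined by the finer one.\<close>

lemma similar_mono: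
  assumes "similar N' D' x y" "N \<le> N'" "D dvd D'" "D' \<ge> 1"
  shows "similar N D x y"
proof -
  obtain E where E: "D' = D * E"
    using assms by auto
  with assms(4) have DE: "D \<ge> 1" "E \<ge> 1"
    by (auto simp: Suc_le_eq)
  have "\<pi> (gdiv G (x i) D) = \<rho> (gdiv H (y i) D)" for i
  proof -
    have x: "x i \<in> carrier G" "y i \<in> carrier H" and eq: "\<pi> (gdiv G (x i) D') = \<rho> (gdiv H (y i) D')"
      using assms(1) by (auto simp: similar_def)
    have "gdiv G (x i) D = gdiv G (x i) D' [^]\<^bsub>G\<^esub> E"
      using G.gdiv_gdiv[OF x(1) DE] G.gdiv_power[OF DE(2) G.gdiv_closed[OF DE(1) x(1)]] E by simp
    moreover have "gdiv H (y i) D = gdiv H (y i) D' [^]\<^bsub>H\<^esub> E"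
      using H.gdiv_gdiv[OF x(2) DE] H.gdiv_power[OF DE(2) H.gdiv_closed[OF DE(1) x(2)]] E by simp
    ultimately show ?thesis
      using eq x assms(4) by (simp add: G.\<pi>.hom_nat_pow H.\<pi>.hom_nat_pow)
  qed
  then show ?thesis
    using assms(1,2) by (auto simp: similar_def)
qed

text \<open>Division by \<open>D\<close> and both projections commute with integral combinations, so
  agreement on the entries carries over to forms of any weight.\<close>

lemma similar_pi_lincomb:
  assumes "similar N D x y" "D \<ge> 1"
  shows "\<pi> (gdiv G (lincomb G x l) D) = \<rho> (gdiv H (lincomb H y l) D)"
proof -
  have xy: "\<And>i. x i \<in> carrier G" "\<And>i. y i \<in> carrier H"
    and eq: "\<And>i. \<pi> (gdiv G (x i) D) = \<rho> (gdiv H (y i) D)"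
    using assms by (auto simp: similar_def)
  show ?thesis
    using xy assms(2) G.comm_group_axioms H.comm_group_axioms
    by (simp add: G.gdiv_lincomb H.gdiv_lincomb G.\<pi>.hom_lincomb H.\<pi>.hom_lincomb eq)
qed

lemma pi_incl_div:
  assumes "n \<ge> 1"
  shows "\<pi> (gdiv G (\<iota> k) n) = \<rho> (gdiv H (\<kappa> k) n)"
proof -
  have "\<iota> k = \<iota> 1 [^]\<^bsub>G\<^esub> k" "\<kappa> k = \<kappa> 1 [^]\<^bsub>H\<^esub> k"
    by (simp_all add: G.incl_int_pow H.incl_int_pow)
  then show ?thesis
    using assms
    by (simp add: G.gdiv_int_pow H.gdiv_int_pow G.\<pi>.hom_int_pow H.\<pi>.hom_int_pow same_torsion)
qed

text \<open>A relation in \<open>H\<close> makes the projection of the combination vanish, so its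
  counterpart in \<open>G\<close> lies in the kernel and equals some \<open>\<iota> k'\<close>.
  Transferring that relation to \<open>H\<close> forces \<open>k' = k\<close>.\<close>

lemma similar_relation_iff:
  assumes "similar N 1 x y" "weight l \<le> N"
  shows "lincomb G x l = \<iota> k \<longleftrightarrow> lincomb H y l = \<kappa> k"
proof
  assume y: "lincomb H y l = \<kappa> k"
  have xy: "\<And>i. x i \<in> carrier G" "\<And>i. y i \<in> carrier H"
    using assms by (auto simp: similar_def)
  have "\<pi> (lincomb G x l) = \<rho> (lincomb H y l)"
    using similar_pi_lincomb[OF assms(1), of l] xy by simp
  then obtain k' where k': "lincomb G x l = \<iota> k'"
    using y xy G.pi_eq_0_iff[of "lincomb G x l"] by auto
  then have "lincomb H y l = \<kappa> k'"
    using assms by (simp add: similar_def)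
  with y k' show "lincomb G x l = \<iota> k"
    by simp
qed (use assms in \<open>simp add: similar_def\<close>)

text \<open>This serves the moves in which the element to be matched is chosen in
  \<open>H\<close>.\<close>

lemma similar_swap:
  assumes "similar N D x y" "D \<ge> 1"
  shows "rz_extension_pair.similar H \<kappa> \<rho> G \<iota> \<pi> N D y x"
proof -
  interpret swap: rz_extension_pair H \<kappa> \<rho> G \<iota> \<pi>
    by unfold_locales (simp add: same_torsion)
  have "similar N 1 x y"
    using similar_mono[OF assms(1)] assms(2) by simp
  from similar_relation_iff[OF this] show ?thesis
    using assms(1) by (auto simp: similar_def swap.similar_def)
qed

end

text \<open>One step of Gaussian elimination over the integers: after multiplication by
  \<open>c\<close>, the occurrences of \<open>g\<close> are replaced through its relation, leaving a
  form in the old entries and an integer.\<close>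

lemma (in rz_extension) eliminate_var:
  assumes x: "\<And>i. x i \<in> carrier G" and g: "g \<in> carrier G"
    and rel: "g [^] (c::int) = \<iota> k \<otimes> inv (lincomb G x r)"
  shows "lincomb G (x(j := g)) l [^] c =
    \<iota> (coef j l * k) \<otimes> lincomb G x (scale_form c (drop_var j l) @ scale_form (- coef j l) r)"
proof -
  let ?R = "lincomb G x r" and ?L = "lincomb G x (drop_var j l)" and ?m = "coef j l"
  have [simp]: "?R \<in> carrier G" "?L \<in> carrier G"
    using x by simp_all
  have "lincomb G (x(j := g)) l [^] c = (g [^] ?m) [^] c \<otimes> ?L [^] c"
    using x g by (simp add: lincomb_upd int_pow_distrib)
  also have "(g [^] ?m) [^] c = (g [^] c) [^] ?m"
    using g by (simp add: int_pow_pow mult.commute)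
  also have "\<dots> = \<iota> (?m * k) \<otimes> ?R [^] (- ?m)"
    by (simp add: rel int_pow_distrib incl_int_pow int_pow_inv int_pow_neg)
  also have "\<dots> \<otimes> ?L [^] c = \<iota> (?m * k) \<otimes> (?L [^] c \<otimes> ?R [^] (- ?m))"
    by (simp add: m_ac)
  also have "?L [^] c \<otimes> ?R [^] (- ?m) =
      lincomb G x (scale_form c (drop_var j l) @ scale_form (- ?m) r)"
    using x by (simp add: lincomb_append lincomb_scale_form)
  finally show ?thesis .
qed

context rz_extension_pair
begin

text \<open>Eliminating \<open>g\<close> multiplies two forms of weight at most \<open>N\<close> by
  coefficients at most \<open>N\<close>, whence the bound \<open>2 * N * N\<close>. The factor
  \<open>fact N\<close> provides the division by \<open>c * D\<close> for every possible
  \<open>c\<close>.\<close>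

lemma similar_extend_dependent:
  assumes sim: "similar (2 * N * N) (D * fact N) x y" and "D \<ge> 1" and g: "g \<in> carrier G"
    and c: "1 \<le> c" "c \<le> N" and r: "weight r \<le> N"
    and rel: "g [^]\<^bsub>G\<^esub> (c::nat) \<otimes>\<^bsub>G\<^esub> lincomb G x r = \<iota> k"
  shows "\<exists>h. similar N D (x(j := g)) (y(j := h))"
proof -
  have x: "\<And>i. x i \<in> carrier G" and y: "\<And>i. y i \<in> carrier H"
    using sim by (auto simp: similar_def)
  let ?R = "lincomb G x r" and ?S = "lincomb H y r"
  have [simp]: "?R \<in> carrier G" "?S \<in> carrier H"
    using x y by simp_all
  \<comment> \<open>The relation satisfied by \<open>g\<close> over \<open>x\<close>, solved over
    \<open>y\<close>.\<close>
  define h where "h = gdiv H (\<kappa> k \<otimes>\<^bsub>H\<^esub> inv\<^bsub>H\<^esub> ?S) c"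
  have h: "h \<in> carrier H" "h [^]\<^bsub>H\<^esub> c = \<kappa> k \<otimes>\<^bsub>H\<^esub> inv\<^bsub>H\<^esub> ?S"
    using c by (simp_all add: h_def H.gdiv_power)
  have gc: "g [^]\<^bsub>G\<^esub> c = \<iota> k \<otimes>\<^bsub>G\<^esub> inv\<^bsub>G\<^esub> ?R"
    using rel g G.inv_solve_right[of "g [^]\<^bsub>G\<^esub> c" "\<iota> k" ?R] by simp
  have gdiv_g: "g = gdiv G (\<iota> k \<otimes>\<^bsub>G\<^esub> inv\<^bsub>G\<^esub> ?R) c"
    using G.gdiv_unique[OF c(1) g gc] by simp
  have cD: "c * D \<ge> 1"
    using c \<open>D \<ge> 1\<close> by simp
  have "c dvd fact N"
    using c by (intro dvd_fact)
  then have sim': "similar (2 * N * N) (c * D) x y"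
    using similar_mono[OF sim, of "2 * N * N" "c * D"] \<open>D \<ge> 1\<close>
    by (simp add: mult.commute mult_dvd_mono Suc_le_eq)
  have "similar N D x y"
    using similar_mono[OF sim'] cD by simp
  moreover have "\<pi> (gdiv G g D) = \<rho> (gdiv H h D)"
  proof -
    have "\<pi> (gdiv G g D) = \<pi> (gdiv G (\<iota> k) (c * D)) \<otimes>\<^bsub>RZ\<^esub> inv\<^bsub>RZ\<^esub> \<pi> (gdiv G ?R (c * D))"
      using c \<open>D \<ge> 1\<close> cD G.gdiv_closed[OF cD]
      by (subst gdiv_g) (simp add: G.gdiv_gdiv G.gdiv_mult G.gdiv_inv)
    also have "\<dots> = \<rho> (gdiv H (\<kappa> k) (c * D)) \<otimes>\<^bsub>RZ\<^esub> inv\<^bsub>RZ\<^esub> \<rho> (gdiv H ?S (c * D))"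
      using similar_pi_lincomb[OF sim' cD] pi_incl_div[OF cD] by simp
    also have "\<dots> = \<rho> (gdiv H h D)"
      using c \<open>D \<ge> 1\<close> cD H.gdiv_closed[OF cD]
      by (simp add: h_def H.gdiv_gdiv H.gdiv_mult H.gdiv_inv)
    finally show ?thesis .
  qed
  moreover have "lincomb H (y(j := h)) l = \<kappa> m"
    if l: "weight l \<le> N" "lincomb G (x(j := g)) l = \<iota> m" for l m
  proof -
    let ?F = "scale_form (int c) (drop_var j l) @ scale_form (- coef j l) r"
    note el = G.eliminate_var[where x = x and c = "int c" and k = k and r = r and j = j and l = l, OF x g]
    have "\<iota> (int c * m) = \<iota> (coef j l * k) \<otimes>\<^bsub>G\<^esub> lincomb G x ?F"
      using el gc l by (simp add: int_pow_int G.incl_nat_pow)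
    moreover have "\<iota> (int c * m) = \<iota> (coef j l * k) \<otimes>\<^bsub>G\<^esub> \<iota> (int c * m - coef j l * k)"
      by (simp add: G.incl_add[symmetric])
    ultimately have "lincomb G x ?F = \<iota> (int c * m - coef j l * k)"
      using x G.Units_l_cancel[of "\<iota> (coef j l * k)" "lincomb G x ?F"] by simp
    moreover have "weight ?F \<le> 2 * N * N"
    proof -
      have "nat \<bar>coef j l\<bar> \<le> N" "weight (drop_var j l) \<le> N"
        using weight_drop_var[of j l] l by auto
      then have "c * weight (drop_var j l) \<le> N * N" "nat \<bar>coef j l\<bar> * weight r \<le> N * N"
        using c r by (auto intro: mult_le_mono)
      then show ?thesis
        by (simp add: weight_append weight_scale_form)
    qed
    ultimately have "lincomb H y ?F = \<kappa> (int c * m - coef j l * k)"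
      using sim' by (simp add: similar_def)
    \<comment> \<open>The eliminated relation gives the desired equation multiplied by
      \<open>c\<close>; torsion-freeness then cancels \<open>c\<close>.\<close>
    then have "lincomb H (y(j := h)) l [^]\<^bsub>H\<^esub> c = \<kappa> m [^]\<^bsub>H\<^esub> c"
      using H.eliminate_var[where x = y and c = "int c" and k = k and r = r and j = j and l = l, OF y h(1)] h(2)
      by (simp add: int_pow_int H.incl_nat_pow H.incl_add[symmetric])
    then show ?thesis
      using H.nat_pow_cancel[of "lincomb H (y(j := h)) l" "\<kappa> m" c] y h(1) c by simp
  qed
  ultimately have "similar N D (x(j := g)) (y(j := h))"
    using g h(1) by (simp add: similar_def)
  then show ?thesis ..
qed

text \<open>By independence, a short relation over the extended tuple cannot involve
  \<open>g\<close>, so it is one over \<open>x\<close> and already transfers. Only the projection of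
  \<open>h\<close> at level \<open>D\<close> has to be arranged.\<close>

lemma similar_extend_independent:
  assumes sim: "similar N D x y" and "D \<ge> 1" and g: "g \<in> carrier G"
    and ind: "\<And>c r k. \<lbrakk>1 \<le> c; c \<le> N; weight r \<le> N\<rbrakk> \<Longrightarrow>
      g [^]\<^bsub>G\<^esub> (c::nat) \<otimes>\<^bsub>G\<^esub> lincomb G x r \<noteq> \<iota> k"
  shows "\<exists>h. similar N D (x(j := g)) (y(j := h))"
proof -
  have x: "\<And>i. x i \<in> carrier G" and y: "\<And>i. y i \<in> carrier H"
    using sim by (auto simp: similar_def)
  \<comment> \<open>The lift is taken at level \<open>D\<close>, and \<open>h\<close> is its
    \<open>D\<close>-fold multiple, so that \<open>h/D\<close> is \<open>z\<close>.\<close>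
  obtain z where z: "z \<in> carrier H" "\<rho> z = \<pi> (gdiv G g D)"
    using H.pi_surj[of "\<pi> (gdiv G g D)"] g \<open>D \<ge> 1\<close> by auto
  define h where "h = z [^]\<^bsub>H\<^esub> D"
  have h: "h \<in> carrier H" "gdiv H h D = z"
    using z H.gdiv_unique[OF \<open>D \<ge> 1\<close> z(1)] by (simp_all add: h_def)
  have "lincomb H (y(j := h)) l = \<kappa> m"
    if l: "weight l \<le> N" "lincomb G (x(j := g)) l = \<iota> m" for l m
  proof -
    let ?c = "coef j l" and ?r = "drop_var j l"
    have w: "nat \<bar>?c\<bar> \<le> N" "weight ?r \<le> N"
      using weight_drop_var[of j l] l by auto
    have rel: "g [^]\<^bsub>G\<^esub> ?c \<otimes>\<^bsub>G\<^esub> lincomb G x ?r = \<iota> m"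
      using l x g by (simp add: G.lincomb_upd)
    have "?c = 0"
    proof (rule ccontr)
      \<comment> \<open>Independence is stated for positive coefficients; multiplying the relation
        by the sign of the coefficient reduces to them without raising the weight.\<close>
      assume c: "?c \<noteq> 0"
      have "(g [^]\<^bsub>G\<^esub> ?c \<otimes>\<^bsub>G\<^esub> lincomb G x ?r) [^]\<^bsub>G\<^esub> sgn ?c =
          g [^]\<^bsub>G\<^esub> int (nat \<bar>?c\<bar>) \<otimes>\<^bsub>G\<^esub> lincomb G x (scale_form (sgn ?c) ?r)"
        using x g
        by (simp add: G.int_pow_distrib G.int_pow_pow G.lincomb_scale_form abs_sgn[symmetric])
      then have "g [^]\<^bsub>G\<^esub> nat \<bar>?c\<bar> \<otimes>\<^bsub>G\<^esub> lincomb G x (scale_form (sgn ?c) ?r) = \<iota> (sgn ?c * m)"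
        by (simp only: rel G.incl_int_pow int_pow_int)
      moreover have "weight (scale_form (sgn ?c) ?r) \<le> N"
        using w by (simp add: weight_scale_form sgn_if)
      ultimately show False
        using ind[of "nat \<bar>?c\<bar>"] w c by (simp add: Suc_le_eq)
    qed
    then have "lincomb G x ?r = \<iota> m"
      using rel x by simp
    then have "lincomb H y ?r = \<kappa> m"
      using sim w by (simp add: similar_def)
    then show ?thesis
      using \<open>?c = 0\<close> y h by (simp add: H.lincomb_upd)
  qed
  then have "similar N D (x(j := g)) (y(j := h))"
    using sim g h z by (simp add: similar_def)
  then show ?thesis ..
qed

lemma similar_extend:
  assumes sim: "similar (2 * N * N) (D * fact N) x y" and "D \<ge> 1" and g: "g \<in> carrier G"
  shows "\<exists>h. similar N D (x(j := g)) (y(j := h))"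
proof (cases "\<exists>c r k. 1 \<le> c \<and> c \<le> N \<and> weight r \<le> N \<and>
    g [^]\<^bsub>G\<^esub> (c::nat) \<otimes>\<^bsub>G\<^esub> lincomb G x r = \<iota> k")
  case True
  then show ?thesis
    using similar_extend_dependent[OF assms] by blast
next
  case False
  have "similar N D x y"
    by (rule similar_mono[OF sim]) (use \<open>D \<ge> 1\<close> in \<open>simp_all add: Suc_le_eq\<close>)
  then show ?thesis
    using similar_extend_independent[OF _ \<open>D \<ge> 1\<close> g] False by blast
qed

end

section \<open>Elementary equivalence\<close>

lemma ext_structure_simps [simp]:
  "Gam (ext_structure G \<iota> \<pi>) = UNIV" "gam_add (ext_structure G \<iota> \<pi>) = (+)"
  "gam_one (ext_structure G \<iota> \<pi>) = 1" "Grp (ext_structure G \<iota> \<pi>) = carrier G"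
  "grp_add (ext_structure G \<iota> \<pi>) = (\<lambda>x y. x \<otimes>\<^bsub>G\<^esub> y)" "Fld (ext_structure G \<iota> \<pi>) = UNIV"
  "fld_add (ext_structure G \<iota> \<pi>) = (+)" "fld_mult (ext_structure G \<iota> \<pi>) = (*)"
  "incl (ext_structure G \<iota> \<pi>) = \<iota>" "proj (ext_structure G \<iota> \<pi>) = \<pi>"
  by (simp_all add: ext_structure_def)

text \<open>All extensions interpret the kernel sort by the same integers, so one fixed structure
  can evaluate its terms.\<close>

lemma gam_val_ext_structure:
  "gam_val (ext_structure G \<iota> \<pi>) u t = gam_val standard_model u t"
  by (induction t) (simp_all add: standard_model_def)

text \<open>A group term is an integral form in the group variables plus an integer from the kernel;
  \<open>int_part\<close> collects the latter.\<close>

primrec form_of :: "grp_tm \<Rightarrow> lin_form" where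
  "form_of (GrpVar i) = [(i, 1)]"
| "form_of (GrpAdd s t) = form_of s @ form_of t"
| "form_of (Incl t) = []"

primrec int_part :: "(nat \<Rightarrow> int) \<Rightarrow> grp_tm \<Rightarrow> int" where
  "int_part u (GrpVar i) = 0"
| "int_part u (GrpAdd s t) = int_part u s + int_part u t"
| "int_part u (Incl t) = gam_val standard_model u t"

context rz_extension
begin

lemma grp_val_eq:
  assumes "\<And>i. v i \<in> carrier G"
  shows "grp_val (ext_structure G \<iota> \<pi>) u v t = lincomb G v (form_of t) \<otimes> \<iota> (int_part u t)"
  using assms
  by (induction t) (simp_all add: lincomb_append incl_add m_ac gam_val_ext_structure)

lemma pi_grp_val:
  assumes "\<And>i. v i \<in> carrier G"
  shows "\<pi> (grp_val (ext_structure G \<iota> \<pi>) u v t) = \<pi> (lincomb G v (form_of t))"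
proof -
  have "\<pi> (lincomb G v (form_of t)) \<in> carrier RZ"
    using assms by simp
  then show ?thesis
    using assms by (simp add: grp_val_eq RZ_mult in_carrier_RZ frac_eq)
qed

text \<open>Moving the variables to one side and the integers to the other turns an equation into a
  relation of the kind that \<open>similar\<close> controls.\<close>

lemma grp_val_eq_iff:
  assumes "\<And>i. v i \<in> carrier G"
  shows "grp_val (ext_structure G \<iota> \<pi>) u v s = grp_val (ext_structure G \<iota> \<pi>) u v t \<longleftrightarrow>
    lincomb G v (form_of s @ scale_form (- 1) (form_of t)) = \<iota> (int_part u t - int_part u s)"
proof -
  let ?s = "lincomb G v (form_of s)" and ?t = "lincomb G v (form_of t)"
  let ?m = "int_part u s" and ?n = "int_part u t"
  have [simp]: "?s \<in> carrier G" "?t \<in> carrier G"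
    using assms by simp_all
  have "\<iota> ?n = \<iota> (?n - ?m) \<otimes> \<iota> ?m"
    by (simp add: incl_add[symmetric])
  then have "?s \<otimes> \<iota> ?m = ?t \<otimes> \<iota> ?n \<longleftrightarrow> ?s \<otimes> \<iota> ?m = (?t \<otimes> \<iota> (?n - ?m)) \<otimes> \<iota> ?m"
    by (simp add: m_assoc)
  also have "\<dots> \<longleftrightarrow> ?s = \<iota> (?n - ?m) \<otimes> ?t"
    by (simp add: m_comm)
  also have "\<dots> \<longleftrightarrow> ?s \<otimes> inv ?t = \<iota> (?n - ?m)"
    using inv_solve_right[of "\<iota> (?n - ?m)" ?s ?t] inv_solve_right'[of "\<iota> (?n - ?m)" ?s ?t] by auto
  finally show ?thesis
    using assms by (simp add: grp_val_eq lincomb_append lincomb_scale_form int_pow_neg)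
qed

end

context rz_extension_pair
begin

text \<open>The bounds \<open>N\<close> and \<open>D\<close> depend on the formula alone. They are
  built from the atoms outwards, and each group quantifier raises them as
  \<open>similar_extend\<close> demands.\<close>

lemma similar_imp_agree:
  "\<exists>N D. D \<ge> 1 \<and> (\<forall>u w x y. similar N D x y \<longrightarrow>
     L_sat (ext_structure G \<iota> \<pi>) u x w \<phi> = L_sat (ext_structure H \<kappa> \<rho>) u y w \<phi>)"
proof (induction \<phi>)
  case (GamEq s t)
  then show ?case
    by (rule exI[of _ 0], rule exI[of _ 1]) (simp add: gam_val_ext_structure)
next
  case (GrpEq s t)
  let ?l = "form_of s @ scale_form (- 1) (form_of t)"
  show ?case
  proof (rule exI[of _ "weight ?l"], rule exI[of _ 1], intro conjI allI impI)
    fix u and w :: "nat \<Rightarrow> real" and x y assume sim: "similar (weight ?l) 1 x y"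
    then have "\<And>i. x i \<in> carrier G" "\<And>i. y i \<in> carrier H"
      by (auto simp: similar_def)
    then show "L_sat (ext_structure G \<iota> \<pi>) u x w (GrpEq s t) =
        L_sat (ext_structure H \<kappa> \<rho>) u y w (GrpEq s t)"
      by (simp only: L_sat.simps G.grp_val_eq_iff H.grp_val_eq_iff
          similar_relation_iff[OF sim order_refl])
  qed simp
next
  case (FldEq s t)
  show ?case
  proof (rule exI[of _ 0], rule exI[of _ 1], intro conjI allI impI)
    \<comment> \<open>Field terms see group elements only through the projections, so weight 0 and
      level 1 suffice.\<close>
    fix u w x y assume sim: "similar 0 1 x y"
    then have xy: "\<And>i. x i \<in> carrier G" "\<And>i. y i \<in> carrier H"
      by (auto simp: similar_def)
    have "\<pi> (lincomb G x l) = \<rho> (lincomb H y l)" for l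
      using similar_pi_lincomb[OF sim, of l] xy by simp
    then have "fld_val (ext_structure G \<iota> \<pi>) u x w t = fld_val (ext_structure H \<kappa> \<rho>) u y w t" for t
      using xy by (induction t) (simp_all add: G.pi_grp_val H.pi_grp_val)
    then show "L_sat (ext_structure G \<iota> \<pi>) u x w (FldEq s t) =
        L_sat (ext_structure H \<kappa> \<rho>) u y w (FldEq s t)"
      by simp
  qed simp
next
  case (Neg \<phi>)
  then show ?case by simp
next
  case (Conj \<phi> \<psi>)
  then obtain N D N' D' where D: "D \<ge> 1" "D' \<ge> 1"
    and IH: "\<And>u w x y. similar N D x y \<Longrightarrow>
      L_sat (ext_structure G \<iota> \<pi>) u x w \<phi> = L_sat (ext_structure H \<kappa> \<rho>) u y w \<phi>"
      "\<And>u w x y. similar N' D' x y \<Longrightarrow>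
      L_sat (ext_structure G \<iota> \<pi>) u x w \<psi> = L_sat (ext_structure H \<kappa> \<rho>) u y w \<psi>"
    by blast
  show ?case
  proof (rule exI[of _ "max N N'"], rule exI[of _ "D * D'"], intro conjI allI impI)
    show DD: "D * D' \<ge> 1"
      using D by simp
    fix u w x y assume "similar (max N N') (D * D') x y"
    then have "similar N D x y" "similar N' D' x y"
      using DD by (auto intro: similar_mono)
    then show "L_sat (ext_structure G \<iota> \<pi>) u x w (Conj \<phi> \<psi>) =
        L_sat (ext_structure H \<kappa> \<rho>) u y w (Conj \<phi> \<psi>)"
      by (simp add: IH)
  qed
next
  case (Forall a i \<phi>)
  then obtain N D where D: "D \<ge> 1" and IH: "\<And>u w x y. similar N D x y \<Longrightarrow>
      L_sat (ext_structure G \<iota> \<pi>) u x w \<phi> = L_sat (ext_structure H \<kappa> \<rho>) u y w \<phi>"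
    by blast
  show ?case
  proof (cases a)
    case GrpS
    interpret swap: rz_extension_pair H \<kappa> \<rho> G \<iota> \<pi>
      by unfold_locales (simp add: same_torsion)
    show ?thesis
    proof (rule exI[of _ "2 * N * N"], rule exI[of _ "D * fact N"], intro conjI allI impI)
      show DN: "D * fact N \<ge> 1"
        using D by (simp add: Suc_le_eq)
      fix u w x y assume sim: "similar (2 * N * N) (D * fact N) x y"
      have "\<exists>h\<in>carrier H. similar N D (x(i := g)) (y(i := h))" if g: "g \<in> carrier G" for g
      proof -
        obtain h where sh: "similar N D (x(i := g)) (y(i := h))"
          using similar_extend[OF sim D g] by blast
        then have "(y(i := h)) i \<in> carrier H"
          unfolding similar_def by blast
        with sh show ?thesis by auto
      qed
      moreover have "\<exists>g\<in>carrier G. similar N D (x(i := g)) (y(i := h))" if h: "h \<in> carrier H" for h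
      proof -
        obtain g where "swap.similar N D (y(i := h)) (x(i := g))"
          using swap.similar_extend[OF similar_swap[OF sim DN] D h] by blast
        then have sg: "similar N D (x(i := g)) (y(i := h))"
          using swap.similar_swap D by blast
        then have "(x(i := g)) i \<in> carrier G"
          unfolding similar_def by blast
        with sg show ?thesis by auto
      qed
      ultimately show "L_sat (ext_structure G \<iota> \<pi>) u x w (Forall a i \<phi>) =
          L_sat (ext_structure H \<kappa> \<rho>) u y w (Forall a i \<phi>)"
        using GrpS IH by simp metis
    qed
  \<comment> \<open>For kernel and field quantifiers the same element is taken on both sides, and
    the bounds do not change.\<close>
  qed (rule exI[of _ N], rule exI[of _ D], simp add: D[simplified] IH)+
qed

end

section \<open>From formulas to sentences\<close>

lemma gam_val_cong:
  "(\<And>i. (GamS, i) \<in> gam_vars t \<Longrightarrow> u i = u' i) \<Longrightarrow> gam_val S u t = gam_val S u' t"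
  by (induction t) simp_all

lemma grp_val_cong:
  "(\<And>i. (GamS, i) \<in> grp_vars t \<Longrightarrow> u i = u' i) \<Longrightarrow> (\<And>i. (GrpS, i) \<in> grp_vars t \<Longrightarrow> v i = v' i)
    \<Longrightarrow> grp_val S u v t = grp_val S u' v' t"
  by (induction t) (simp_all add: gam_val_cong[of _ u u'])

lemma fld_val_cong:
  "(\<And>i. (GamS, i) \<in> fld_vars t \<Longrightarrow> u i = u' i) \<Longrightarrow> (\<And>i. (GrpS, i) \<in> fld_vars t \<Longrightarrow> v i = v' i)
    \<Longrightarrow> (\<And>i. (FldS, i) \<in> fld_vars t \<Longrightarrow> w i = w' i)
    \<Longrightarrow> fld_val S u v w t = fld_val S u' v' w' t"
  by (induction t) (simp_all add: grp_val_cong[of _ u u' v v'])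

lemma L_sat_cong:
  assumes "\<And>i. (GamS, i) \<in> free_vars \<phi> \<Longrightarrow> u i = u' i" "\<And>i. (GrpS, i) \<in> free_vars \<phi> \<Longrightarrow> v i = v' i"
    "\<And>i. (FldS, i) \<in> free_vars \<phi> \<Longrightarrow> w i = w' i"
  shows "L_sat S u v w \<phi> = L_sat S u' v' w' \<phi>"
  using assms
proof (induction \<phi> arbitrary: u u' v v' w w')
  case (GamEq s t)
  then show ?case
    using gam_val_cong[of s u u' S] gam_val_cong[of t u u' S] by simp
next
  case (GrpEq s t)
  then show ?case
    using grp_val_cong[of s u u' v v' S] grp_val_cong[of t u u' v v' S] by simp
next
  case (FldEq s t)
  then show ?case
    using fld_val_cong[of s u u' v v' w w' S] fld_val_cong[of t u u' v v' w w' S] by simp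
next
  case (Neg \<phi>)
  show ?case
    using Neg.IH[of u u' v v' w w'] Neg.prems by simp
next
  case (Conj \<phi> \<psi>)
  show ?case
    using Conj.IH(1)[of u u' v v' w w'] Conj.IH(2)[of u u' v v' w w'] Conj.prems by simp
next
  case (Forall a i \<phi>)
  show ?case
  proof (cases a)
    case GamS
    have "L_sat S (u(i := x)) v w \<phi> = L_sat S (u'(i := x)) v' w' \<phi>" for x
      by (rule Forall.IH) (use Forall.prems GamS in auto)
    then show ?thesis
      by (simp add: GamS)
  next
    case GrpS
    have "L_sat S u (v(i := x)) w \<phi> = L_sat S u' (v'(i := x)) w' \<phi>" for x
      by (rule Forall.IH) (use Forall.prems GrpS in auto)
    then show ?thesis
      by (simp add: GrpS)
  next
    case FldS
    have "L_sat S u v (w(i := x)) \<phi> = L_sat S u' v' (w'(i := x)) \<phi>" for x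
      by (rule Forall.IH) (use Forall.prems FldS in auto)
    then show ?thesis
      by (simp add: FldS)
  qed
qed

lemma L_models_sentence:
  assumes "free_vars \<phi> = {}" "range u \<subseteq> Gam S" "range v \<subseteq> Grp S" "range w \<subseteq> Fld S"
  shows "L_models S \<phi> \<longleftrightarrow> L_sat S u v w \<phi>"
  unfolding L_models_def using assms L_sat_cong[of \<phi>] by (metis empty_iff)

lemma (in comm_group) lincomb_one [simp]: "lincomb G (\<lambda>i. \<one>) l = \<one>"
  by (induction l) simp_all

text \<open>The constant tuples of neutral elements are matched for all bounds: every form vanishes
  on them, so only the relations with \<open>k = 0\<close> hold.\<close>

lemma (in rz_extension_pair) elem_equiv: "ext_structure G \<iota> \<pi> \<equiv>\<^sub>L ext_structure H \<kappa> \<rho>"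
  unfolding elem_equiv_def
proof (intro allI impI)
  fix \<phi> assume \<phi>: "free_vars \<phi> = {}"
  obtain N D where D: "D \<ge> 1" and agree: "\<And>u w x y. similar N D x y \<Longrightarrow>
      L_sat (ext_structure G \<iota> \<pi>) u x w \<phi> = L_sat (ext_structure H \<kappa> \<rho>) u y w \<phi>"
    using similar_imp_agree[of \<phi>] by blast
  let ?u = "\<lambda>_. 0" and ?w = "\<lambda>_. 0" and ?x = "\<lambda>_. \<one>\<^bsub>G\<^esub>" and ?y = "\<lambda>_. \<one>\<^bsub>H\<^esub>"
  have "similar N D ?x ?y"
    using D by (auto simp: similar_def dest!: sym[of "\<one>\<^bsub>G\<^esub>"])
  from agree[OF this]
  have "L_sat (ext_structure G \<iota> \<pi>) ?u ?x ?w \<phi> = L_sat (ext_structure H \<kappa> \<rho>) ?u ?y ?w \<phi>" .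
  then show "L_models (ext_structure G \<iota> \<pi>) \<phi> \<longleftrightarrow> L_models (ext_structure H \<kappa> \<rho>) \<phi>"
    using L_models_sentence[OF \<phi>, of ?u "ext_structure G \<iota> \<pi>" ?x ?w]
      L_models_sentence[OF \<phi>, of ?u "ext_structure H \<kappa> \<rho>" ?y ?w] by auto
qed

section \<open>Expressing the torsion condition by sentences\<close>

primrec grp_multiple :: "nat \<Rightarrow> grp_tm" where
  "grp_multiple 0 = GrpVar 0"
| "grp_multiple (Suc n) = GrpAdd (grp_multiple n) (GrpVar 0)"

primrec fld_multiple :: "nat \<Rightarrow> fld_tm" where
  "fld_multiple 0 = Proj (GrpVar 0)"
| "fld_multiple (Suc n) = FldAdd (fld_multiple n) (Proj (GrpVar 0))"

text \<open>It says that \<open>(n + 1) \<pi>(g) = 1\<close> whenever \<open>(n + 1) g = \<iota>(1)\<close>; the index is shifted so that the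
  multiples need no symbol for zero, and the unit of the field is expressed by its action.\<close>

definition torsion_sentence :: "nat \<Rightarrow> L_form" where
  "torsion_sentence n = Forall GrpS 0 (Forall FldS 0
     (Neg (Conj (GrpEq (grp_multiple n) (Incl GamOne))
       (Neg (FldEq (FldMult (fld_multiple n) (FldVar 0)) (FldVar 0))))))"

lemma free_vars_torsion_sentence: "free_vars (torsion_sentence n) = {}"
proof -
  have "grp_vars (grp_multiple n) = {(GrpS, 0)}" "fld_vars (fld_multiple n) = {(GrpS, 0)}"
    by (induction n) simp_all
  then show ?thesis
    by (auto simp: torsion_sentence_def)
qed

context rz_extension
begin

lemma torsion_sentence_iff:
  "L_models (ext_structure G \<iota> \<pi>) (torsion_sentence n) \<longleftrightarrow>
    real (Suc n) * \<pi> (gdiv G (\<iota> 1) (Suc n)) = 1"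
proof -
  have grp: "grp_val (ext_structure G \<iota> \<pi>) u v (grp_multiple n) = v 0 [^] Suc n"
    if "v 0 \<in> carrier G" for u v
    using that by (induction n) simp_all
  have fld: "fld_val (ext_structure G \<iota> \<pi>) u v w (fld_multiple n) = real (Suc n) * \<pi> (v 0)" for u v w
    by (induction n) (simp_all add: algebra_simps)
  have "L_models (ext_structure G \<iota> \<pi>) (torsion_sentence n) \<longleftrightarrow>
      L_sat (ext_structure G \<iota> \<pi>) (\<lambda>_. 0) (\<lambda>_. \<one>) (\<lambda>_. 0) (torsion_sentence n)"
    by (rule L_models_sentence) (simp_all add: free_vars_torsion_sentence)
  also have "\<dots> \<longleftrightarrow> (\<forall>g\<in>carrier G. g [^] Suc n = \<iota> 1 \<longrightarrow> (\<forall>r. real (Suc n) * \<pi> g * r = r))"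
    by (auto simp: torsion_sentence_def grp fld simp del: nat_pow_Suc of_nat_Suc)
  \<comment> \<open>Taking \<open>r = 1\<close> recovers the equation with the unit.\<close>
  also have "\<dots> \<longleftrightarrow> (\<forall>g\<in>carrier G. g [^] Suc n = \<iota> 1 \<longrightarrow> real (Suc n) * \<pi> g = 1)"
    by (metis mult.right_neutral mult_1)
  also have "\<dots> \<longleftrightarrow> real (Suc n) * \<pi> (gdiv G (\<iota> 1) (Suc n)) = 1"
    using gdiv_unique[of "Suc n"] gdiv_power[of "Suc n" "\<iota> 1"] gdiv_closed[of "Suc n" "\<iota> 1"]
    by (auto simp del: nat_pow_Suc of_nat_Suc)
  finally show ?thesis .
qed

theorem elem_equiv_standard_iff:
  "ext_structure G \<iota> \<pi> \<equiv>\<^sub>L standard_model \<longleftrightarrow>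
    (\<forall>n::nat. n \<ge> 1 \<longrightarrow> \<pi> (gdiv G (\<iota> 1) n) = frac (1 / real n))"
proof
  interpret R: rz_extension real_add_group of_int frac
    by (rule rz_extension_real)
  {
    assume equiv: "ext_structure G \<iota> \<pi> \<equiv>\<^sub>L standard_model"
    show "\<forall>n::nat. n \<ge> 1 \<longrightarrow> \<pi> (gdiv G (\<iota> 1) n) = frac (1 / real n)"
    proof (intro allI impI)
      fix n :: nat assume n: "n \<ge> 1"
      show "\<pi> (gdiv G (\<iota> 1) n) = frac (1 / real n)"
      \<comment> \<open>For \<open>n = 1\<close> both sides are 0, whereas the torsion sentence of
        index 0 would claim the value 1; hence the separate case.\<close>
      proof (cases "n = 1")
        case False
        then obtain m where m: "n = Suc m" "m \<ge> 1"
          using n by (cases n) auto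
        have fr: "frac (1 / real n) = 1 / real n"
          using m by (simp add: frac_eq)
        then have "L_models standard_model (torsion_sentence m)"
          using m by (simp add: standard_model_def R.torsion_sentence_iff gdiv_real)
        then have "L_models (ext_structure G \<iota> \<pi>) (torsion_sentence m)"
          using equiv free_vars_torsion_sentence by (auto simp: elem_equiv_def)
        then show ?thesis
          using m fr by (simp add: torsion_sentence_iff field_simps)
      qed simp
    qed
  next
    assume *: "\<forall>n::nat. n \<ge> 1 \<longrightarrow> \<pi> (gdiv G (\<iota> 1) n) = frac (1 / real n)"
    interpret rz_extension_pair G \<iota> \<pi> real_add_group of_int frac
      by unfold_locales (use * in \<open>simp add: gdiv_real\<close>)
    show "ext_structure G \<iota> \<pi> \<equiv>\<^sub>L standard_model"
      using elem_equiv by (simp add: standard_model_def)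
  }
qed

end

section \<open>Isomorphism and the image in the inverse limit\<close>

text \<open>Rationals are fixed, and squares go to squares, so the order is preserved. Density of
  the rationals then leaves only the identity.\<close>

lemma real_field_endomorphism_id:
  fixes c :: "real \<Rightarrow> real"
  assumes inj: "inj c" and add: "\<And>x y. c (x + y) = c x + c y" and mult: "\<And>x y. c (x * y) = c x * c y"
  shows "c x = x"
proof -
  have c0: "c 0 = 0"
    using add[of 0 0] by simp
  have "c 1 \<noteq> 0"
    using inj c0 by (metis injD zero_neq_one)
  then have c1: "c 1 = 1"
    using mult[of 1 1] by simp
  have minus: "c (- x) = - c x" for x
    using add[of x "- x"] c0 by simp
  have nat: "c (real n) = real n" for n
    by (induction n) (simp_all add: c0 c1 add)
  have int: "c (of_int k) = of_int k" for k
    by (cases k rule: int_cases2) (simp_all add: nat minus)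
  have rat: "c (of_rat q) = of_rat q" for q
  proof (cases q)
    case (Fract a b)
    then have "of_rat q * real_of_int b = of_int a"
      by (simp add: of_rat_rat)
    then have "c (of_rat q) * of_int b = of_int a"
      by (metis int mult)
    with Fract \<open>of_rat q * real_of_int b = of_int a\<close> show ?thesis
      by (metis less_irrefl mult_right_cancel of_int_eq_0_iff)
  qed
  have nonneg: "c x \<ge> 0" if "x \<ge> 0" for x
    using mult[of "sqrt x" "sqrt x"] that by (metis real_sqrt_mult_self abs_of_nonneg zero_le_square)
  have mono: "c x \<le> c y" if "x \<le> y" for x y
    using nonneg[of "y - x"] add[of x "y - x"] that by simp
  show ?thesis
  proof (rule antisym)
    show "c x \<le> x"
    proof (rule ccontr)
      assume "\<not> c x \<le> x"
      then obtain q where q: "x < of_rat q" "of_rat q < c x"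
        using of_rat_dense[of x "c x"] by auto
      then show False
        using mono[of x "of_rat q"] by (simp add: rat)
    qed
    show "x \<le> c x"
    proof (rule ccontr)
      assume "\<not> x \<le> c x"
      then obtain q where q: "c x < of_rat q" "of_rat q < x"
        using of_rat_dense[of "c x" x] by auto
      then show False
        using mono[of "of_rat q" x] by (simp add: rat)
    qed
  qed
qed

context rz_extension
begin

lemma pi_hat_apply: "n \<ge> 1 \<Longrightarrow> pi_hat G \<pi> x n = \<pi> (gdiv G x n)"
  by (simp add: pi_hat_def)

text \<open>An element of the kernel is a multiple of \<open>\<iota>(1)\<close>, and no nonzero integer is divisible by all
  positive integers.\<close>

lemma inj_on_pi_hat: "inj_on (pi_hat G \<pi>) (carrier G)"
proof (rule inj_onI)
  fix x y assume xy: "x \<in> carrier G" "y \<in> carrier G" and eq: "pi_hat G \<pi> x = pi_hat G \<pi> y"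
  define z where "z = x \<otimes> inv y"
  have z: "z \<in> carrier G"
    using xy by (simp add: z_def)
  have div: "\<exists>k. gdiv G z n = \<iota> k" if "n \<ge> 1" for n
  proof -
    have "\<pi> (gdiv G x n) = \<pi> (gdiv G y n)"
      using eq that by (metis pi_hat_apply)
    then have "\<pi> (gdiv G z n) = 0"
      using xy that by (simp add: z_def gdiv_mult gdiv_inv flip: RZ_one)
    then show ?thesis
      using z that by (auto simp: pi_eq_0_iff)
  qed
  obtain k where k: "z = \<iota> k"
    using div[of 1] z by auto
  \<comment> \<open>The divisor is chosen larger than the absolute value of \<open>k\<close>, so it
    can divide \<open>k\<close> only if \<open>k = 0\<close>.\<close>
  obtain j where "gdiv G z (nat \<bar>k\<bar> + 1) = \<iota> j"
    using div[of "nat \<bar>k\<bar> + 1"] by auto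
  then have "k = (\<bar>k\<bar> + 1) * j"
    using k z gdiv_power[of "nat \<bar>k\<bar> + 1" z] by (simp add: incl_nat_pow incl_add[symmetric] algebra_simps)
  then have "(\<bar>k\<bar> + 1) dvd k"
    by (metis dvd_triv_left)
  then have "k = 0"
    using zdvd_imp_le[of "\<bar>k\<bar> + 1" "\<bar>k\<bar>"] by (cases "k = 0") auto
  then have "z = \<one>"
    using k by simp
  then show "x = y"
    using xy by (metis z_def inv_closed inv_equality inv_inv)
qed

end

section \<open>Homomorphisms over the circle and the images in the inverse limit\<close>

lemma hom_gdiv:
  assumes "rz_extension G \<iota> \<pi>" "rz_extension H \<kappa> \<rho>" "b \<in> hom G H" "x \<in> carrier G" "n \<ge> 1"
  shows "b (gdiv G x n) = gdiv H (b x) n"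
proof -
  interpret G: rz_extension G \<iota> \<pi> by fact
  interpret H: rz_extension H \<kappa> \<rho> by fact
  interpret b: group_hom G H b
    using assms(3) by unfold_locales
  have "b (gdiv G x n) [^]\<^bsub>H\<^esub> n = b x"
    using assms(4,5) G.gdiv_power[of n x] by (metis b.hom_nat_pow G.gdiv_closed)
  then show ?thesis
    using assms(4,5) by (intro H.gdiv_unique[symmetric]) auto
qed

text \<open>Homomorphisms respect unique division, so compatibility with the projections passes to
  every coordinate.\<close>

lemma pi_hat_hom_eq:
  assumes "rz_extension G \<iota> \<pi>" "rz_extension H \<kappa> \<rho>" "b \<in> hom G H"
    and "\<And>x. x \<in> carrier G \<Longrightarrow> \<rho> (b x) = \<pi> x" "x \<in> carrier G"
  shows "pi_hat H \<rho> (b x) = pi_hat G \<pi> x"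
proof -
  interpret G: rz_extension G \<iota> \<pi> by fact
  show ?thesis
    using assms(4)[OF G.gdiv_closed[OF _ assms(5)]] hom_gdiv[OF assms(1-3,5)]
    by (auto simp: pi_hat_def fun_eq_iff)
qed

text \<open>Rigidity of the field makes the field component the identity, so the group component is
  an isomorphism over the circle.\<close>

lemma isomorphic_imp_iso:
  assumes "ext_structure G \<iota> \<pi> \<cong>\<^sub>L (ext_structure H \<kappa> \<rho>)\<lparr>gam_one := e\<rparr>"
  obtains b where "b \<in> iso G H" "\<And>x. x \<in> carrier G \<Longrightarrow> \<rho> (b x) = \<pi> x"
proof -
  obtain b and c :: "real \<Rightarrow> real" where bij: "bij_betw b (carrier G) (carrier H)" "bij c"
    and b: "\<And>x y. \<lbrakk>x \<in> carrier G; y \<in> carrier G\<rbrakk> \<Longrightarrow> b (x \<otimes>\<^bsub>G\<^esub> y) = b x \<otimes>\<^bsub>H\<^esub> b y"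
    and c: "\<And>x y. c (x + y) = c x + c y" "\<And>x y. c (x * y) = c x * c y"
    and cb: "\<And>x. x \<in> carrier G \<Longrightarrow> c (\<pi> x) = \<rho> (b x)"
    using assms by (auto simp: L_isomorphic_def)
  have "c x = x" for x
    using real_field_endomorphism_id[OF _ c] bij by (auto simp: bij_def)
  moreover have "b \<in> iso G H"
    using bij b by (auto simp: iso_def hom_def bij_betw_def)
  ultimately show thesis
    using that cb by auto
qed

lemma isomorphic_imp_image_eq:
  assumes "rz_extension G \<iota> \<pi>" "rz_extension H \<kappa> \<rho>"
    and "ext_structure G \<iota> \<pi> \<cong>\<^sub>L (ext_structure H \<kappa> \<rho>)\<lparr>gam_one := e\<rparr>"
  shows "pi_hat G \<pi> ` carrier G = pi_hat H \<rho> ` carrier H"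
proof -
  obtain b where b: "b \<in> iso G H" "\<And>x. x \<in> carrier G \<Longrightarrow> \<rho> (b x) = \<pi> x"
    using isomorphic_imp_iso[OF assms(3)] by metis
  have "pi_hat H \<rho> ` (b ` carrier G) = pi_hat G \<pi> ` carrier G"
    using pi_hat_hom_eq[OF assms(1,2) _ b(2)] b(1) by (auto simp: iso_def image_image)
  then show ?thesis
    using b(1) by (simp add: iso_def bij_betw_def)
qed

text \<open>The comparison map sends \<open>\<iota>(1)\<close> to some \<open>\<kappa>(e)\<close>; dividing by \<open>|e|\<close> forces \<open>e = \<plusminus>1\<close>, so that
  inclusion of the images already makes it an isomorphism.\<close>

lemma image_subset_imp_iso:
  assumes "rz_extension G \<iota> \<pi>" "rz_extension H \<kappa> \<rho>"
    and sub: "pi_hat G \<pi> ` carrier G \<subseteq> pi_hat H \<rho> ` carrier H"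
  obtains b and e :: int where "b \<in> iso G H" "e \<in> {1, - 1}"
    "\<And>x. x \<in> carrier G \<Longrightarrow> \<rho> (b x) = \<pi> x" "\<And>k. b (\<iota> k) = \<kappa> (e * k)"
proof -
  interpret G: rz_extension G \<iota> \<pi> by fact
  interpret H: rz_extension H \<kappa> \<rho> by fact
  have "\<forall>x\<in>carrier G. \<exists>y. y \<in> carrier H \<and> pi_hat H \<rho> y = pi_hat G \<pi> x"
    using sub by (auto simp: image_iff dest!: subsetD)
  \<comment> \<open>Injectivity of \<open>pi_hat H \<rho>\<close> makes the value \<open>b x\<close>
    unique, which yields additivity below.\<close>
  then obtain b where bc: "\<And>x. x \<in> carrier G \<Longrightarrow> b x \<in> carrier H"
    and hat: "\<And>x. x \<in> carrier G \<Longrightarrow> pi_hat H \<rho> (b x) = pi_hat G \<pi> x"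
    by metis
  have hom: "b \<in> hom G H"
  proof (rule homI)
    fix x y assume xy: "x \<in> carrier G" "y \<in> carrier G"
    have "pi_hat H \<rho> (b (x \<otimes>\<^bsub>G\<^esub> y)) = pi_hat H \<rho> (b x \<otimes>\<^bsub>H\<^esub> b y)"
      using xy bc hat pi_hat_hom[OF G.ext] pi_hat_hom[OF H.ext] by (simp add: hom_mult)
    then show "b (x \<otimes>\<^bsub>G\<^esub> y) = b x \<otimes>\<^bsub>H\<^esub> b y"
      using H.inj_on_pi_hat xy bc by (simp add: inj_on_eq_iff)
  qed (rule bc)
  then interpret b: group_hom G H b
    by unfold_locales
  have \<rho>b: "\<rho> (b x) = \<pi> x" if "x \<in> carrier G" for x
    using hat[OF that] that bc G.pi_hat_apply[of 1 x] H.pi_hat_apply[of 1 "b x"] by simp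
  have inj: "inj_on b (carrier G)"
    by (rule inj_onI) (metis hat G.inj_on_pi_hat inj_onD)
  obtain e where e: "b (\<iota> 1) = \<kappa> e"
    using \<rho>b[of "\<iota> 1"] H.pi_eq_0_iff[of "b (\<iota> 1)"] by auto
  have b\<iota>: "b (\<iota> k) = \<kappa> (e * k)" for k
  proof -
    have "b (\<iota> k) = b (\<iota> 1 [^]\<^bsub>G\<^esub> k)"
      by (simp add: G.incl_int_pow)
    also have "\<dots> = \<kappa> (e * k)"
      by (simp only: b.hom_int_pow[OF G.incl_closed] e H.incl_int_pow mult.commute)
    finally show ?thesis .
  qed
  have "e \<noteq> 0"
    using b\<iota>[of 1] inj_onD[OF inj, of "\<iota> 1" "\<one>\<^bsub>G\<^esub>"] by auto
  \<comment> \<open>The quotient \<open>\<iota>(1)/n\<close> goes to \<open>\<kappa>(sgn e)\<close>,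
    so it lies in the kernel of \<open>\<pi>\<close> and is some \<open>\<iota> j\<close>. Then
    \<open>n * j = 1\<close>.\<close>
  define n where "n = nat \<bar>e\<bar>"
  have n: "n \<ge> 1" "int n * sgn e = e"
    using \<open>e \<noteq> 0\<close> by (auto simp: n_def abs_mult_sgn Suc_le_eq)
  have "gdiv H (\<kappa> e) n = \<kappa> (sgn e)"
    using n by (intro H.gdiv_unique) (auto simp: H.incl_nat_pow)
  then have "b (gdiv G (\<iota> 1) n) = \<kappa> (sgn e)"
    using hom_gdiv[OF assms(1,2) hom _ n(1), of "\<iota> 1"] e by simp
  then have "\<pi> (gdiv G (\<iota> 1) n) = 0"
    using \<rho>b[of "gdiv G (\<iota> 1) n"] n by simp
  then obtain j where "gdiv G (\<iota> 1) n = \<iota> j"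
    using n G.pi_eq_0_iff[of "gdiv G (\<iota> 1) n"] by auto
  then have "int n * j = 1"
    using G.gdiv_power[OF n(1), of "\<iota> 1"] by (simp add: G.incl_nat_pow)
  then have "int n = 1"
    by (auto simp: zmult_eq_1_iff)
  then have e1: "e \<in> {1, - 1}"
    by (auto simp: n_def)
  have "b ` carrier G = carrier H"
  proof (intro equalityI subsetI)
    fix y assume y: "y \<in> carrier H"
    \<comment> \<open>An element of \<open>H\<close> and the image of a lift of its projection
      differ by an integer, which \<open>b\<close> also attains because \<open>e\<close> is
      invertible.\<close>
    obtain x where x: "x \<in> carrier G" "\<pi> x = \<rho> y"
      using G.pi_surj[of "\<rho> y"] y by auto
    have "\<rho> (y \<otimes>\<^bsub>H\<^esub> inv\<^bsub>H\<^esub> b x) = 0"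
      using x y bc \<rho>b by (simp flip: RZ_one)
    then obtain m where "y \<otimes>\<^bsub>H\<^esub> inv\<^bsub>H\<^esub> b x = \<kappa> m"
      using x y bc H.pi_eq_0_iff[of "y \<otimes>\<^bsub>H\<^esub> inv\<^bsub>H\<^esub> b x"] by auto
    then have "y = \<kappa> m \<otimes>\<^bsub>H\<^esub> b x"
      using x y bc H.inv_solve_right'[of y "\<kappa> m" "b x"] by (metis H.incl_closed H.inv_solve_right)
    also have "\<kappa> m = b (\<iota> (e * m))"
      using e1 by (auto simp: b\<iota>)
    finally have "y = b (\<iota> (e * m) \<otimes>\<^bsub>G\<^esub> x)"
      using x by simp
    then show "y \<in> b ` carrier G"
      using x by (intro image_eqI[of _ _ "\<iota> (e * m) \<otimes>\<^bsub>G\<^esub> x"]) simp_all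
  qed (use bc in auto)
  then have "b \<in> iso G H"
    using hom inj by (simp add: iso_def bij_betw_def)
  then show thesis
    using that e1 \<rho>b b\<iota> by blast
qed

text \<open>The kernel component is multiplication by \<open>e\<close>, its own inverse, and the
  field component is the identity.\<close>

lemma iso_imp_isomorphic:
  assumes "b \<in> iso G H" "e \<in> {1, - 1}"
    "\<And>x. x \<in> carrier G \<Longrightarrow> \<rho> (b x) = \<pi> x" "\<And>k. b (\<iota> k) = \<kappa> (e * k)"
  shows "ext_structure G \<iota> \<pi> \<cong>\<^sub>L (ext_structure H \<kappa> \<rho>)\<lparr>gam_one := e\<rparr>"
proof -
  have "bij ((*) e)"
    using assms(2) by (intro o_bij[of "(*) e"]) (auto simp: fun_eq_iff)
  then show ?thesis
    unfolding L_isomorphic_def using assms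
    by (intro exI[of _ "(*) e"] exI[of _ b] exI[of _ "\<lambda>x. x"])
      (auto simp: iso_def hom_def algebra_simps bij_betw_def)
qed

text \<open>The sign left open by the comparison map is absorbed by the choice of generator.\<close>

theorem isomorphic_gen_iff_image_eq:
  assumes "rz_extension G \<iota> \<pi>" "rz_extension H \<kappa> \<rho>"
  shows "ext_structure G \<iota> \<pi> \<cong>\<^sub>\<plusminus> ext_structure H \<kappa> \<rho> \<longleftrightarrow>
    pi_hat G \<pi> ` carrier G = pi_hat H \<rho> ` carrier H"
proof
  assume "pi_hat G \<pi> ` carrier G = pi_hat H \<rho> ` carrier H"
  then show "ext_structure G \<iota> \<pi> \<cong>\<^sub>\<plusminus> ext_structure H \<kappa> \<rho>"
    using image_subset_imp_iso[OF assms] iso_imp_isomorphic unfolding L_isomorphic_gen_def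
    by (metis subset_refl)
qed (use isomorphic_imp_image_eq[OF assms] in \<open>auto simp: L_isomorphic_gen_def\<close>)

text \<open>The torsion values given by elementary equivalence fix the sign of the generator, so the
  comparison map must have \<open>e = 1\<close>.\<close>

theorem isomorphic_iff_image_eq:
  assumes ext: "rz_extension G \<iota> \<pi>" "rz_extension H \<kappa> \<rho>"
    and equiv: "ext_structure G \<iota> \<pi> \<equiv>\<^sub>L standard_model" "ext_structure H \<kappa> \<rho> \<equiv>\<^sub>L standard_model"
  shows "ext_structure G \<iota> \<pi> \<cong>\<^sub>L ext_structure H \<kappa> \<rho> \<longleftrightarrow>
    pi_hat G \<pi> ` carrier G = pi_hat H \<rho> ` carrier H"
proof
  have one: "(ext_structure H \<kappa> \<rho>)\<lparr>gam_one := 1\<rparr> = ext_structure H \<kappa> \<rho>"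
    by (simp add: ext_structure_def)
  {
    assume "ext_structure G \<iota> \<pi> \<cong>\<^sub>L ext_structure H \<kappa> \<rho>"
    then show "pi_hat G \<pi> ` carrier G = pi_hat H \<rho> ` carrier H"
      using isomorphic_imp_image_eq[OF ext, of 1] one by simp
  next
    interpret G: rz_extension G \<iota> \<pi> by fact
    interpret H: rz_extension H \<kappa> \<rho> by fact
    assume "pi_hat G \<pi> ` carrier G = pi_hat H \<rho> ` carrier H"
    then obtain b e where b: "b \<in> iso G H" "e \<in> {1, - 1}"
      "\<And>x. x \<in> carrier G \<Longrightarrow> \<rho> (b x) = \<pi> x" "\<And>k. b (\<iota> k) = \<kappa> (e * k)"
      using image_subset_imp_iso[OF ext] by (metis subset_refl)
    \<comment> \<open>Three is the least \<open>n\<close> for which \<open>1/n\<close> differs from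
      its inverse in the circle; division by two would not detect the sign.\<close>
    have third: "frac (1 / 3 :: real) = 1 / 3"
      by (simp add: frac_eq)
    have third_RZ: "1 / 3 \<in> carrier RZ"
      by (simp add: in_carrier_RZ)
    have G3: "\<pi> (gdiv G (\<iota> 1) 3) = 1 / 3" and H3: "\<rho> (gdiv H (\<kappa> 1) 3) = 1 / 3"
      using equiv third by (auto simp: G.elem_equiv_standard_iff H.elem_equiv_standard_iff)
    have "e \<noteq> - 1"
    proof
      assume "e = - 1"
      then have "b (\<iota> 1) = inv\<^bsub>H\<^esub> \<kappa> 1"
        using b(4)[of 1] by (simp add: H.incl_uminus)
      then have "b (gdiv G (\<iota> 1) 3) = inv\<^bsub>H\<^esub> gdiv H (\<kappa> 1) 3"
        using hom_gdiv[OF ext, of b "\<iota> 1" 3] b(1) by (simp add: iso_def H.gdiv_inv)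
      then have "1 / 3 = inv\<^bsub>RZ\<^esub> (1 / 3 :: real)"
        using b(3)[of "gdiv G (\<iota> 1) 3"] G3 H3 by simp
      then have "(1 / 3 :: real) \<otimes>\<^bsub>RZ\<^esub> (1 / 3) = 0"
        using RZ.r_inv[of "1 / 3"] third_RZ by (metis RZ_one)
      then show False
        by (simp add: RZ_mult frac_eq)
    qed
    then have "e = 1"
      using b(2) by auto
    then show "ext_structure G \<iota> \<pi> \<cong>\<^sub>L ext_structure H \<kappa> \<rho>"
      using iso_imp_isomorphic[where \<rho> = \<rho> and \<pi> = \<pi> and \<iota> = \<iota> and \<kappa> = \<kappa>, OF b] one by simp
  }
qed

section \<open>Coverings\<close>

lemma frac_eq_frac_iff: "frac x = frac y \<longleftrightarrow> (\<exists>k. x = y + of_int k)" for x y :: real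
proof
  assume "frac x = frac y"
  then have "x = y + of_int (\<lfloor>x\<rfloor> - \<lfloor>y\<rfloor>)"
    by (simp add: frac_def)
  then show "\<exists>k. x = y + of_int k" ..
qed (auto simp: frac_add_of_int)

lemma frac_eq_frac_iff': "frac x = frac y \<longleftrightarrow> (\<exists>k. x + of_int k = y)" for x y :: real
  by (metis frac_eq_frac_iff)

text \<open>The set of reals lying over the image of \<open>U\<close> is the union of the integer
  translates of \<open>U\<close>.\<close>

lemma open_map_frac: "open_map euclideanreal RZ_topology frac"
  unfolding open_map_def
proof (intro allI impI)
  fix U :: "real set" assume U: "openin euclideanreal U"
  have "{x. frac x \<in> frac ` U} = (\<Union>k::int. (\<lambda>x. x + of_int k) -` U)"
    unfolding image_iff Bex_def frac_eq_frac_iff' by auto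
  moreover have "open ((\<lambda>x. x + of_int k) -` U)" for k :: int
    using U by (intro open_vimage) (auto intro!: continuous_intros)
  ultimately have "open {x. frac x \<in> frac ` U}"
    by auto
  then show "openin RZ_topology (frac ` U)"
    by (auto simp: openin_RZ_topology in_carrier_RZ frac_lt_1)
qed

text \<open>The topology of the line is pulled back along \<open>b\<close>. Then
  \<open>\<pi>\<close> is \<open>frac\<close> after \<open>b\<close>, and the sheets are preimages
  of integer translates of an interval.\<close>

lemma iso_real_imp_covering:
  assumes ext: "rz_extension G \<iota> \<pi>" and b: "b \<in> iso G real_add_group"
    and \<pi>: "\<And>x. x \<in> carrier G \<Longrightarrow> frac (b x) = \<pi> x"
  shows "\<exists>X. topological_group G X \<and> covering_map X RZ_topology \<pi>"
proof -
  interpret G: rz_extension G \<iota> \<pi> by fact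
  have bij: "inj_on b (carrier G)" "b ` carrier G = UNIV"
    and hom: "\<And>x y. \<lbrakk>x \<in> carrier G; y \<in> carrier G\<rbrakk> \<Longrightarrow> b (x \<otimes>\<^bsub>G\<^esub> y) = b x + b y"
    using b by (auto simp: iso_def bij_betw_def hom_def real_add_group_def)
  define X where "X = pullback_topology (carrier G) b euclideanreal"
  have top: "topspace X = carrier G"
    by (simp add: X_def topspace_pullback_topology)
  have cont_b: "continuous_map X euclideanreal b"
    using continuous_map_pullback[of euclideanreal euclideanreal id] by (simp add: X_def)
  \<comment> \<open>The universal property of the pulled-back topology: continuity into
    \<open>X\<close> is tested after \<open>b\<close>.\<close>
  have into_X: "continuous_map Z X f"
    if "continuous_map Z euclideanreal (\<lambda>z. b (f z))" "f ` topspace Z \<subseteq> carrier G" for Z :: "'c topology" and f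
    unfolding X_def using that by (intro continuous_map_pullback') (auto simp: comp_def)
  have "topological_group G X"
    unfolding topological_group_def
  proof (intro conjI)
    show "continuous_map (prod_topology X X) X (\<lambda>(x, y). x \<otimes>\<^bsub>G\<^esub> y)"
    proof (rule into_X)
      have "continuous_map (prod_topology X X) euclideanreal (\<lambda>p. b (fst p) + b (snd p))"
        by (intro continuous_map_add continuous_map_compose[OF continuous_map_fst cont_b, unfolded comp_def]
            continuous_map_compose[OF continuous_map_snd cont_b, unfolded comp_def])
      then show "continuous_map (prod_topology X X) euclideanreal (\<lambda>z. b (case z of (x, y) \<Rightarrow> x \<otimes>\<^bsub>G\<^esub> y))"
        by (rule continuous_map_eq) (auto simp: top hom)
    qed (auto simp: top)
    show "continuous_map X X (\<lambda>x. inv\<^bsub>G\<^esub> x)"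
    proof (rule into_X)
      have "b (inv\<^bsub>G\<^esub> x) = - b x" if "x \<in> carrier G" for x
        using hom[of x "inv\<^bsub>G\<^esub> x"] hom[of "\<one>\<^bsub>G\<^esub>" "\<one>\<^bsub>G\<^esub>"] that by simp
      then show "continuous_map X euclideanreal (\<lambda>x. b (inv\<^bsub>G\<^esub> x))"
        by (intro continuous_map_eq[OF continuous_map_minus[OF cont_b]]) (simp add: top)
    qed (auto simp: top)
  qed (simp_all add: top G.is_group)
  moreover have "covering_map X RZ_topology \<pi>"
    unfolding covering_map_def
  proof (intro conjI ballI)
    have cont: "continuous_map X RZ_topology \<pi>"
      using continuous_map_compose[OF cont_b quotient_imp_continuous_map[OF quotient_map_frac]]
      by (rule continuous_map_eq) (simp add: top \<pi>)
    then show "continuous_map X RZ_topology \<pi>" .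
    show "\<pi> ` topspace X = topspace RZ_topology"
      using G.ext by (simp add: top topspace_RZ_topology RZ_extension_def epi_def)
    have "open_map X euclideanreal b"
      unfolding open_map_def X_def openin_pullback_topology
    proof (intro allI impI)
      fix U assume "\<exists>T. openin euclideanreal T \<and> U = b -` T \<inter> carrier G"
      then obtain T where T: "open T" "U = b -` T \<inter> carrier G"
        by auto
      then have "b ` U = T"
        using bij(2) by (auto simp: image_iff set_eq_iff) metis
      with T show "openin euclideanreal (b ` U)"
        by simp
    qed
    then have om: "open_map X RZ_topology \<pi>"
      using open_map_eq[OF open_map_compose[OF _ open_map_frac], of X b \<pi>] \<pi> by (simp add: top)
    fix y assume "y \<in> topspace RZ_topology"
    then have y: "frac y = y"
      by (simp add: topspace_RZ_topology in_carrier_RZ frac_eq)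
    \<comment> \<open>An open interval of length 1 has disjoint integer translates, and
      \<open>frac\<close> is injective on it; the sheets \<open>W k\<close> inherit both
      properties.\<close>
    define I where "I = {y - 1/2 <..< y + 1/2}"
    define T where "T = frac ` I"
    define W where "W = (\<lambda>k::int. {x \<in> carrier G. b x + of_int k \<in> I})"
    have T: "openin RZ_topology T"
      using open_map_frac by (simp add: open_map_def T_def I_def)
    have "y \<in> T"
      using y unfolding T_def I_def by (intro image_eqI[of _ _ y]) auto
    moreover have "\<Union> (range W) = topspace X \<inter> \<pi> -` T"
    proof -
      have "\<pi> x \<in> T \<longleftrightarrow> (\<exists>k::int. b x + of_int k \<in> I)" if "x \<in> carrier G" for x
        unfolding \<pi>[OF that, symmetric] T_def image_iff Bex_def frac_eq_frac_iff' by auto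
      then show ?thesis
        by (auto simp: W_def top)
    qed
    moreover have W: "openin X (W k)" for k
    proof -
      have "open ((\<lambda>t. t + of_int k) -` I)"
        unfolding I_def by (intro open_vimage) (auto intro!: continuous_intros)
      moreover have "W k = b -` ((\<lambda>t. t + of_int k) -` I) \<inter> carrier G"
        by (auto simp: W_def)
      ultimately show ?thesis
        unfolding X_def openin_pullback_topology by auto
    qed
    moreover have "pairwise disjnt (range W)"
    proof (rule pairwiseI)
      fix U U' assume "U \<in> range W" "U' \<in> range W" "U \<noteq> U'"
      then obtain k k' where k: "U = W k" "U' = W k'" "k \<noteq> k'"
        by auto
      have False if "b x + of_int k \<in> I" "b x + of_int k' \<in> I" for x
      proof -
        have "\<bar>of_int (k - k') :: real\<bar> < 1"
          using that by (auto simp: I_def)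
        then show False
          using k(3) by linarith
      qed
      then show "disjnt U U'"
        by (auto simp: disjnt_def k W_def)
    qed
    moreover have "homeomorphic_map (subtopology X (W k)) (subtopology RZ_topology T) \<pi>" for k
    proof (rule bijective_open_imp_homeomorphic_map)
      have "\<pi> x = frac (b x + of_int k)" if "x \<in> W k" for x
        using that \<pi> by (simp add: W_def frac_add_of_int)
      then have im: "\<pi> ` W k = T"
      proof -
        have "(\<lambda>x. b x + of_int k) ` W k = I"
        proof (intro equalityI subsetI)
          fix t assume t: "t \<in> I"
          obtain x where "x \<in> carrier G" "b x = t - of_int k"
            using bij(2) by (metis UNIV_I imageE)
          with t show "t \<in> (\<lambda>x. b x + of_int k) ` W k"
            by (intro image_eqI[of _ _ x]) (auto simp: W_def)
        qed (auto simp: W_def)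
        then show ?thesis
          using \<open>\<And>x. x \<in> W k \<Longrightarrow> \<pi> x = frac (b x + of_int k)\<close> unfolding T_def
          by (metis (no_types, lifting) image_cong image_image)
      qed
      have tops: "topspace (subtopology X (W k)) = W k" "topspace (subtopology RZ_topology T) = T"
        using openin_subset[OF W, of k] openin_subset[OF T] by (auto simp: topspace_subtopology_subset)
      show "continuous_map (subtopology X (W k)) (subtopology RZ_topology T) \<pi>"
        using im by (intro continuous_map_into_subtopology continuous_map_from_subtopology cont)
          (auto simp: tops)
      show "\<pi> ` topspace (subtopology X (W k)) = topspace (subtopology RZ_topology T)"
        by (simp only: tops im)
      show "open_map (subtopology X (W k)) (subtopology RZ_topology T) \<pi>"
        using om im unfolding open_map_def
        by (auto simp: openin_open_subtopology[OF W] openin_open_subtopology[OF T])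
      show "inj_on \<pi> (topspace (subtopology X (W k)))"
        unfolding tops
      proof (rule inj_onI)
        fix x x' assume x: "x \<in> W k" "x' \<in> W k" and "\<pi> x = \<pi> x'"
        then have "frac (b x) = frac (b x')"
          using \<pi> by (simp add: W_def)
        then obtain j where j: "b x = b x' + of_int j"
          by (auto simp: frac_eq_frac_iff)
        then have "\<bar>of_int j :: real\<bar> < 1"
          using x by (auto simp: W_def I_def)
        then have "b x = b x'"
          using j by (simp add: abs_less_iff)
        then show "x = x'"
          using bij(1) x by (auto simp: W_def inj_on_def)
      qed
    qed
    ultimately show "\<exists>T. y \<in> T \<and> openin RZ_topology T \<and>
      (\<exists>V. \<Union>V = topspace X \<inter> \<pi> -` T \<and> (\<forall>U \<in> V. openin X U) \<and> pairwise disjnt V \<and>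
           (\<forall>U \<in> V. homeomorphic_map (subtopology X U) (subtopology RZ_topology T) \<pi>))"
      using T by (intro exI[of _ T] conjI exI[of _ "range W"]) auto
  qed
  ultimately show ?thesis
    by blast
qed

section \<open>From a covering to the standard model\<close>

lemma topological_group_continuous_mult:
  assumes "topological_group G X" "continuous_map Z X f" "continuous_map Z X h"
  shows "continuous_map Z X (\<lambda>z. f z \<otimes>\<^bsub>G\<^esub> h z)"
proof -
  have "continuous_map Z (prod_topology X X) (\<lambda>z. (f z, h z))"
    using assms(2,3) by (simp add: continuous_map_paired)
  moreover have "continuous_map (prod_topology X X) X (\<lambda>(x, y). x \<otimes>\<^bsub>G\<^esub> y)"
    using assms(1) by (simp add: topological_group_def)
  ultimately show ?thesis
    using continuous_map_compose by (fastforce simp: comp_def)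
qed

lemma topological_group_continuous_inv:
  assumes "topological_group G X" "continuous_map Z X f"
  shows "continuous_map Z X (\<lambda>z. inv\<^bsub>G\<^esub> f z)"
  using continuous_map_compose[OF assms(2)] assms(1) by (auto simp: topological_group_def comp_def)

text \<open>A continuous section near \<open>0\<close> is additive near \<open>0\<close>: its defect of additivity lies in the
  kernel of \<open>\<pi>\<close> and, by continuity, in a sheet on which \<open>\<pi>\<close> is injective.\<close>

lemma (in rz_extension) covering_local_section:
  assumes top: "topological_group G X" and cov: "covering_map X RZ_topology \<pi>"
  obtains s :: "real \<Rightarrow> 'g" and \<delta> where "\<delta> > 0"
    "\<And>t. \<bar>t\<bar> < \<delta> \<Longrightarrow> s t \<in> carrier G \<and> \<pi> (s t) = frac t"
    "\<And>t t'. \<lbrakk>\<bar>t\<bar> < \<delta>; \<bar>t'\<bar> < \<delta>\<rbrakk> \<Longrightarrow> s (t + t') = s t \<otimes> s t'"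
proof -
  have X: "topspace X = carrier G"
    using top by (simp add: topological_group_def)
  have "0 \<in> topspace RZ_topology"
    by (simp add: topspace_RZ_topology in_carrier_RZ)
  then obtain T V where T: "0 \<in> T" "openin RZ_topology T" and V: "\<Union>V = topspace X \<inter> \<pi> -` T"
    "\<And>U. U \<in> V \<Longrightarrow> openin X U"
    "\<And>U. U \<in> V \<Longrightarrow> homeomorphic_map (subtopology X U) (subtopology RZ_topology T) \<pi>"
    using cov unfolding covering_map_def by metis
  have "\<one> \<in> \<Union>V"
    using T V(1) by (simp add: X)
  \<comment> \<open>The sheet through the neutral element; its inverse map after \<open>frac\<close>
    will be the section, with value \<open>\<one>\<close> at 0.\<close>
  then obtain U where U: "U \<in> V" "\<one> \<in> U"
    by auto
  have topU: "topspace (subtopology X U) = U"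
    using openin_subset[OF V(2)[OF U(1)]] by auto
  have UG: "U \<subseteq> carrier G"
    using openin_subset[OF V(2)[OF U(1)]] X by simp
  have topT: "topspace (subtopology RZ_topology T) = T"
    using openin_subset[OF T(2)] by auto
  obtain g where g: "homeomorphic_maps (subtopology X U) (subtopology RZ_topology T) \<pi> g"
    using V(3)[OF U(1)] by (auto simp: homeomorphic_map_maps)
  then have g\<pi>: "\<And>x. x \<in> U \<Longrightarrow> g (\<pi> x) = x" and \<pi>g: "\<And>t. t \<in> T \<Longrightarrow> \<pi> (g t) = t"
    and cont_g: "continuous_map (subtopology RZ_topology T) (subtopology X U) g"
    unfolding homeomorphic_maps_def topU topT by blast+
  define J where "J = {t::real. frac t \<in> T}"
  define s where "s = (\<lambda>t. g (frac t))"
  have J: "open J" "0 \<in> J"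
    using T by (auto simp: J_def openin_RZ_topology)
  have "continuous_map (top_of_set J) (subtopology RZ_topology T) frac"
    by (intro continuous_map_into_subtopology continuous_map_from_subtopology
        quotient_imp_continuous_map[OF quotient_map_frac]) (auto simp: J_def)
  from continuous_map_compose[OF this cont_g]
  have cont_s: "continuous_map (top_of_set J) X s"
    by (simp add: s_def comp_def continuous_map_in_subtopology)
  have sG: "s t \<in> carrier G" "\<pi> (s t) = frac t" if "t \<in> J" for t
  proof -
    show "s t \<in> carrier G"
      using continuous_map_image_subset_topspace[OF cont_s] that X by auto
    show "\<pi> (s t) = frac t"
      using that \<pi>g by (simp add: s_def J_def)
  qed
  have s0: "s 0 = \<one>"
    using g\<pi>[OF U(2)] by (simp add: s_def)
  \<comment> \<open>On this open set of pairs all three values in the defect of additivity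
    \<open>F\<close> are given by the section.\<close>
  define P where "P = {p. fst p \<in> J \<and> snd p \<in> J \<and> fst p + snd p \<in> J}"
  have "P = fst -` J \<inter> snd -` J \<inter> (\<lambda>p. fst p + snd p) -` J"
    by (auto simp: P_def)
  moreover have "open (fst -` J \<inter> snd -` J \<inter> (\<lambda>p. fst p + snd p) -` J)"
    by (intro open_Int open_vimage J) (auto intro!: continuous_intros)
  ultimately have P: "open P"
    by simp
  define F where "F = (\<lambda>p. s (fst p) \<otimes> s (snd p) \<otimes> inv s (fst p + snd p))"
  have sP: "continuous_map (top_of_set P) X (\<lambda>p. s (f p))"
    if "continuous_on P f" "f \<in> P \<rightarrow> J" for f
    using continuous_map_compose[OF _ cont_s, of "top_of_set P" f] that
    by (simp add: continuous_map_subtopology_eu comp_def)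
  have "continuous_map (top_of_set P) X F"
    unfolding F_def
    by (intro topological_group_continuous_mult[OF top] topological_group_continuous_inv[OF top] sP)
      (auto simp: P_def intro!: continuous_intros)
  then have "openin (top_of_set P) {p \<in> topspace (top_of_set P). F p \<in> U}"
    using V(2)[OF U(1)] by (rule openin_continuous_map_preimage)
  then have "open {p \<in> P. F p \<in> U}"
    using P by (simp add: openin_open_eq)
  moreover have "(0, 0) \<in> {p \<in> P. F p \<in> U}"
    using J U by (simp add: P_def F_def s0)
  ultimately obtain A B where "open A" "open B" "(0, 0) \<in> A \<times> B" "A \<times> B \<subseteq> {p \<in> P. F p \<in> U}"
    by (rule open_prod_elim)
  then have AB: "open A" "open B" "0 \<in> A" "0 \<in> B" "A \<times> B \<subseteq> {p \<in> P. F p \<in> U}"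
    by simp_all
  have "open (A \<inter> B)" "0 \<in> A \<inter> B"
    using AB by auto
  then obtain \<delta> where \<delta>: "\<delta> > 0" "ball 0 \<delta> \<subseteq> A \<inter> B"
    using openE by blast
  have near: "t \<in> J \<and> t' \<in> J \<and> t + t' \<in> J \<and> F (t, t') \<in> U" if "\<bar>t\<bar> < \<delta>" "\<bar>t'\<bar> < \<delta>" for t t'
  proof -
    have "t \<in> ball 0 \<delta>" "t' \<in> ball 0 \<delta>"
      using that by (auto simp: dist_real_def)
    then have "(t, t') \<in> A \<times> B"
      using \<delta>(2) by auto
    then show ?thesis
      using AB(5) by (auto simp: P_def)
  qed
  show thesis
  proof (rule that[of \<delta> s])
    show "\<delta> > 0" by fact
    show "s t \<in> carrier G \<and> \<pi> (s t) = frac t" if "\<bar>t\<bar> < \<delta>" for t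
      using near[OF that that] sG by simp
    show "s (t + t') = s t \<otimes> s t'" if "\<bar>t\<bar> < \<delta>" "\<bar>t'\<bar> < \<delta>" for t t'
    proof -
      note n = near[OF that]
      have c: "s t \<in> carrier G" "s t' \<in> carrier G" "s (t + t') \<in> carrier G"
        using n sG by auto
      have "frac (frac t + frac t') = frac (t + t')"
        by simp
      then have "\<pi> (s t \<otimes> s t') = \<pi> (s (t + t'))"
        using n sG c by (simp add: RZ_mult)
      moreover have "\<pi> (F (t, t')) = \<pi> (s t \<otimes> s t') \<otimes>\<^bsub>RZ\<^esub> inv\<^bsub>RZ\<^esub> \<pi> (s (t + t'))"
        using c by (simp add: F_def)
      ultimately have "\<pi> (F (t, t')) = \<pi> \<one>"
        using c by simp
      then have "F (t, t') = \<one>"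
        using g\<pi> n U(2) by metis
      then have "inv s (t + t') = inv (s t \<otimes> s t')"
        using c by (simp add: F_def) (metis inv_equality m_closed inv_closed inv_inv m_comm)
      then show ?thesis
        using c by (metis inv_inv m_closed)
    qed
  qed
qed

text \<open>Taking multiples commutes with division and projection; this carries agreement from
  small reals to all reals.\<close>

lemma pi_hat_nat_pow_cong:
  assumes "rz_extension G \<iota> \<pi>" "rz_extension H \<kappa> \<rho>" "x \<in> carrier G" "y \<in> carrier H"
    and "pi_hat G \<pi> x = pi_hat H \<rho> y"
  shows "pi_hat G \<pi> (x [^]\<^bsub>G\<^esub> (m::nat)) = pi_hat H \<rho> (y [^]\<^bsub>H\<^esub> m)"
proof -
  interpret G: rz_extension G \<iota> \<pi> by fact
  interpret H: rz_extension H \<kappa> \<rho> by fact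
  have "\<pi> (gdiv G (x [^]\<^bsub>G\<^esub> m) n) = \<rho> (gdiv H (y [^]\<^bsub>H\<^esub> m) n)" if n: "n \<ge> 1" for n
  proof -
    have "\<pi> (gdiv G x n) = \<rho> (gdiv H y n)"
      using assms(5) n by (metis G.pi_hat_apply H.pi_hat_apply)
    then show ?thesis
      using n assms(3,4) G.gdiv_int_pow[of x n "int m"] H.gdiv_int_pow[of y n "int m"]
      by (simp add: int_pow_int G.\<pi>.hom_nat_pow H.\<pi>.hom_nat_pow)
  qed
  then show ?thesis
    by (auto simp: pi_hat_def fun_eq_iff)
qed

text \<open>For small \<open>t\<close>, additivity gives \<open>s(t)/n = s(t/n)\<close>, so
  \<open>s t\<close> and \<open>t\<close> have the same coordinates. An arbitrary real is a multiple
  of a small one.\<close>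

lemma (in rz_extension) covering_imp_image_eq_real:
  assumes "topological_group G X" "covering_map X RZ_topology \<pi>"
  shows "pi_hat real_add_group frac ` carrier real_add_group = pi_hat G \<pi> ` carrier G"
proof -
  note R = rz_extension_real
  interpret R: rz_extension real_add_group of_int frac
    by (rule R)
  obtain s :: "real \<Rightarrow> 'g" and \<delta> where \<delta>: "\<delta> > 0"
    and s: "\<And>t. \<bar>t\<bar> < \<delta> \<Longrightarrow> s t \<in> carrier G \<and> \<pi> (s t) = frac t"
    and add: "\<And>t t'. \<lbrakk>\<bar>t\<bar> < \<delta>; \<bar>t'\<bar> < \<delta>\<rbrakk> \<Longrightarrow> s (t + t') = s t \<otimes> s t'"
    using covering_local_section[OF assms] by metis
  have s0: "s 0 = \<one>"
    using add[of 0 0] s[of 0] \<delta> by simp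
  have mult: "s (real k * t) = s t [^] k" if "real k * \<bar>t\<bar> < \<delta>" "\<bar>t\<bar> < \<delta>" for k t
    using that
  proof (induction k)
    case (Suc k)
    have "real k * \<bar>t\<bar> < \<delta>"
      using Suc.prems by (auto simp: algebra_simps intro: le_less_trans[rotated])
    then have "s (real k * t + t) = s (real k * t) \<otimes> s t"
      using Suc.prems by (intro add) (auto simp: abs_mult)
    then show ?case
      using Suc \<open>real k * \<bar>t\<bar> < \<delta>\<close> by (simp add: algebra_simps)
  qed (simp add: s0)
  have small: "pi_hat G \<pi> (s t) = pi_hat real_add_group frac t" if t: "\<bar>t\<bar> < \<delta>" for t
  proof -
    have "\<pi> (gdiv G (s t) n) = frac (t / real n)" if n: "n \<ge> 1" for n
    proof -
      have "\<bar>t / real n\<bar> \<le> \<bar>t\<bar>"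
        using n by (simp add: field_simps mult_le_cancel_left1)
      then have tn: "\<bar>t / real n\<bar> < \<delta>"
        using t by linarith
      have "s t = s (t / real n) [^] n"
        using mult[of n "t / real n"] n t tn by simp
      then have "gdiv G (s t) n = s (t / real n)"
        using n s[OF tn] by (intro gdiv_unique) auto
      then show ?thesis
        using s[OF tn] by simp
    qed
    then show ?thesis
      by (auto simp: pi_hat_def fun_eq_iff gdiv_real)
  qed
  have "pi_hat real_add_group frac ` carrier real_add_group \<subseteq> pi_hat G \<pi> ` carrier G"
  proof (rule image_subsetI)
    fix t :: real
    obtain m where m: "\<bar>t\<bar> / \<delta> < real m"
      using reals_Archimedean2 by blast
    then have "m > 0"
      using \<delta> by (metis abs_ge_zero divide_nonneg_pos not_gr_zero of_nat_0 order_le_less_trans less_irrefl)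
    then have tm: "\<bar>t / real m\<bar> < \<delta>"
      using m \<delta> by (simp add: field_simps)
    have "pi_hat G \<pi> (s (t / real m) [^] m) =
        pi_hat real_add_group frac ((t / real m) [^]\<^bsub>real_add_group\<^esub> m)"
      by (rule pi_hat_nat_pow_cong[OF rz_extension_axioms R _ _ small[OF tm]])
        (use s[OF tm] in \<open>auto simp: real_add_group_def\<close>)
    also have "(t / real m) [^]\<^bsub>real_add_group\<^esub> m = t"
      using \<open>m > 0\<close> by (simp add: real_add_group_pow)
    finally show "pi_hat real_add_group frac t \<in> pi_hat G \<pi> ` carrier G"
      using s[OF tm] by (intro image_eqI[of _ _ "s (t / real m) [^] m"]) auto
  qed
  \<comment> \<open>The inclusion of images yields an isomorphism, which in turn gives
    equality.\<close>
  then obtain b and e :: int where b: "b \<in> iso real_add_group G" "e \<in> {1, - 1}"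
    "\<And>x. x \<in> carrier real_add_group \<Longrightarrow> \<pi> (b x) = frac x" "\<And>k. b (of_int k) = \<iota> (e * k)"
    using image_subset_imp_iso[OF R rz_extension_axioms] by metis
  show ?thesis
    by (rule isomorphic_imp_image_eq[OF R rz_extension_axioms iso_imp_isomorphic]) (use b in auto)
qed

text \<open>A covering involves only \<open>G\<close> and \<open>\<pi>\<close> and does not see the
  sign of the generator, hence isomorphism up to that sign.\<close>

theorem (in rz_extension) isomorphic_gen_standard_iff_covering:
  "ext_structure G \<iota> \<pi> \<cong>\<^sub>\<plusminus> standard_model \<longleftrightarrow>
    (\<exists>X. topological_group G X \<and> covering_map X RZ_topology \<pi>)"
proof
  assume "ext_structure G \<iota> \<pi> \<cong>\<^sub>\<plusminus> standard_model"
  then obtain e where "ext_structure G \<iota> \<pi> \<cong>\<^sub>L (ext_structure real_add_group of_int frac)\<lparr>gam_one := e\<rparr>"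
    by (auto simp: L_isomorphic_gen_def standard_model_def)
  then obtain b where "b \<in> iso G real_add_group" "\<And>x. x \<in> carrier G \<Longrightarrow> frac (b x) = \<pi> x"
    using isomorphic_imp_iso by metis
  then show "\<exists>X. topological_group G X \<and> covering_map X RZ_topology \<pi>"
    using iso_real_imp_covering[OF rz_extension_axioms] by blast
next
  assume "\<exists>X. topological_group G X \<and> covering_map X RZ_topology \<pi>"
  then have "pi_hat G \<pi> ` carrier G = pi_hat real_add_group frac ` carrier real_add_group"
    using covering_imp_image_eq_real by metis
  then show "ext_structure G \<iota> \<pi> \<cong>\<^sub>\<plusminus> standard_model"
    using isomorphic_gen_iff_image_eq[OF rz_extension_axioms rz_extension_real]
    by (simp add: standard_model_def)
qed

section \<open>Continuum many isomorphism types\<close>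

text \<open>An irrational \<open>\<theta>\<close> and 1 are linearly independent over the rationals,
  so a functional with values 1 and 0 there extends to the reals.\<close>

lemma rational_functional_exists:
  "\<exists>(f :: real \<Rightarrow> real) \<theta>.
    (\<forall>x y. f (x + y) = f x + f y) \<and> (\<forall>x. f x \<in> \<rat>) \<and> (\<forall>x\<in>\<rat>. f x = 0) \<and> f \<theta> = 1"
proof -
  interpret vector_space_pair "\<lambda>(q::rat) (x::real). of_rat q * x" "(*) :: rat \<Rightarrow> rat \<Rightarrow> rat"
    by unfold_locales (simp_all add: algebra_simps of_rat_add of_rat_mult)
  have span1: "vs1.span {1} = \<rat>"
    by (auto simp: vs1.span_singleton Rats_def)
  obtain \<theta> :: real where \<theta>: "\<theta> \<notin> \<rat>"
    using countable_rat uncountable_UNIV_real by (metis UNIV_eq_I)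
  then have "vs1.independent {\<theta>, 1}"
    by (intro vs1.independent_insertI) (auto simp: span1 vs1.independent_empty)
  then obtain g where lin: "Vector_Spaces.linear (\<lambda>q x. of_rat q * x) (*) g"
    and g: "\<forall>x\<in>{\<theta>, 1}. g x = (if x = 1 then 0 else 1)"
    using linear_independent_extend[of "{\<theta>, 1}" "\<lambda>x. if x = 1 then 0 else 1"] by auto
  interpret g: Vector_Spaces.linear "\<lambda>(q::rat) (x::real). of_rat q * x" "(*)" g
    by fact
  have "g (of_rat q) = 0" for q
    using g.scale[of q 1] g by simp
  moreover have "g \<theta> = 1"
    using g \<theta> by auto
  ultimately show ?thesis
    by (intro exI[of _ "\<lambda>x. of_rat (g x)"] exI[of _ \<theta>]) (auto simp: g.add of_rat_add elim!: Rats_cases)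
qed

section \<open>Profinite integers given by factorial sums\<close>

definition fact_sum :: "nat set \<Rightarrow> nat \<Rightarrow> nat" where
  "fact_sum A n = (\<Sum>j \<in> A \<inter> {..<n}. fact j)"

lemma fact_sum_0 [simp]: "fact_sum A 0 = 0"
  by (simp add: fact_sum_def)

lemma fact_sum_Suc: "fact_sum A (Suc n) = fact_sum A n + (if n \<in> A then fact n else 0)"
  by (simp add: fact_sum_def lessThan_Suc Int_insert_right)

text \<open>The last factorial dominates the sum, so the partial sums are small against the next
  factorial; congruences can thus be turned into equalities.\<close>

lemma fact_sum_le: "fact_sum A (Suc n) \<le> 2 * fact n"
proof (induction n)
  case (Suc n)
  have "fact_sum A (Suc (Suc n)) \<le> 2 * fact n + fact (Suc n)"
    using Suc by (subst fact_sum_Suc) auto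
  also have "\<dots> \<le> 2 * fact (Suc n)" if "n \<ge> 1"
  proof -
    have "2 * fact n \<le> (Suc n) * (fact n :: nat)"
      using that by (intro mult_right_mono) auto
    then show ?thesis by simp
  qed
  finally show ?case
    \<comment> \<open>The doubling estimate needs \<open>n \<ge> 1\<close>; the remaining case is
      computed.\<close>
    by (cases "n = 0") (auto simp: fact_sum_Suc)
qed (simp add: fact_sum_Suc)

text \<open>Multiplication by the profinite integer \<open>\<Sum>j\<in>A. j!\<close>, as a homomorphism from \<open>\<rat>\<close> to \<open>\<rat>/\<int>\<close>:
  for a given \<open>q\<close> almost all \<open>q * j!\<close> are integers, and the sum may be cut off there.\<close>

definition profinite_mult :: "nat set \<Rightarrow> real \<Rightarrow> real" where
  "profinite_mult A q = frac (q * real (fact_sum A (LEAST n. q * fact n \<in> \<int>)))"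

lemma Rats_mult_fact_Ints:
  fixes q :: real
  assumes "q \<in> \<rat>"
  shows "\<exists>n. q * fact n \<in> \<int>"
proof -
  obtain a b where ab: "b > 0" "q = of_int a / of_int b"
    using assms by (elim Rats_cases')
  have "int (nat b) dvd int (fact (nat b))"
    using ab(1) by (intro of_nat_dvd_iff[THEN iffD2] dvd_fact) auto
  then obtain c where "fact (nat b) = b * c"
    using ab(1) by (auto simp: dvd_def)
  then have "real_of_int (fact (nat b)) = of_int (b * c)"
    by (rule arg_cong)
  then have "q * fact (nat b) = of_int (a * c)"
    using ab by simp
  then show ?thesis
    by (metis Ints_of_int)
qed

lemma mult_fact_Ints_mono:
  fixes q :: real
  assumes "q * fact n \<in> \<int>" "n \<le> m"
  shows "q * fact m \<in> \<int>"
proof -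
  obtain c where "fact m = fact n * (c::nat)"
    using fact_dvd[OF assms(2), where ?'a = nat] by (auto simp: dvd_def)
  then have "real (fact m) = real (fact n * c)"
    by (rule arg_cong)
  then have "q * fact m = q * fact n * of_nat c"
    by simp
  then show ?thesis
    using assms(1) by (metis Ints_mult Ints_of_nat)
qed

text \<open>Beyond the least cutoff each new term contributes an integer multiple
  \<open>q * k!\<close>, which \<open>frac\<close> ignores, so any valid cutoff may be used.\<close>

lemma profinite_mult_eq:
  assumes "q * fact n \<in> \<int>"
  shows "profinite_mult A q = frac (q * real (fact_sum A n))"
proof -
  let ?m = "LEAST n. q * fact n \<in> \<int>"
  have m: "q * fact ?m \<in> \<int>" "?m \<le> n"
    using assms by (rule LeastI, rule Least_le)
  have "frac (q * real (fact_sum A k)) = frac (q * real (fact_sum A ?m))" if "?m \<le> k" for k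
    using that
  proof (induction k rule: dec_induct)
    case (step k)
    obtain c where "q * fact k = of_int c"
      using mult_fact_Ints_mono[OF m(1) step(1)] by (elim Ints_cases)
    then have "frac (q * real (fact_sum A (Suc k))) = frac (q * real (fact_sum A k))"
      by (simp add: fact_sum_Suc distrib_left frac_add_of_int)
    with step show ?case by simp
  qed simp
  from this[OF m(2)] show ?thesis
    unfolding profinite_mult_def by (rule sym)
qed

text \<open>At a common cutoff the map is an ordinary multiplication; \<open>k\<close> is the carry
  from reducing into \<open>[0,1)\<close>.\<close>

lemma profinite_mult_add:
  assumes "q \<in> \<rat>" "r \<in> \<rat>"
  shows "\<exists>k. profinite_mult A (q + r) = profinite_mult A q + profinite_mult A r + of_int k"
proof -
  obtain m n where mn: "q * fact m \<in> \<int>" "r * fact n \<in> \<int>"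
    using assms Rats_mult_fact_Ints by blast
  define l where "l = max m n"
  have l: "q * fact l \<in> \<int>" "r * fact l \<in> \<int>"
    using mult_fact_Ints_mono[OF mn(1), of l] mult_fact_Ints_mono[OF mn(2), of l] by (auto simp: l_def)
  then have "(q + r) * fact l \<in> \<int>"
    by (simp add: distrib_right)
  then have "profinite_mult A (q + r) = frac ((q + r) * real (fact_sum A l))"
    by (rule profinite_mult_eq)
  moreover have "frac (x + y) = frac x + frac y + of_int (\<lfloor>x\<rfloor> + \<lfloor>y\<rfloor> - \<lfloor>x + y\<rfloor>)" for x y :: real
    by (simp add: frac_def)
  ultimately show ?thesis
    unfolding profinite_mult_eq[OF l(1)] profinite_mult_eq[OF l(2)] distrib_right by metis
qed

text \<open>For integers the cutoff 0 is valid, and its sum is empty.\<close>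

lemma profinite_mult_0 [simp]: "profinite_mult A 0 = 0" and profinite_mult_1: "profinite_mult A 1 = 0"
  using profinite_mult_eq[of 0 0 A] profinite_mult_eq[of 1 0 A] by simp_all

lemma profinite_mult_Rats: "q \<in> \<rat> \<Longrightarrow> profinite_mult A q \<in> \<rat>"
  by (simp add: profinite_mult_def frac_def)

section \<open>Twisted copies of the standard extension\<close>

locale rational_functional =
  fixes f :: "real \<Rightarrow> real" and \<theta> :: real
  assumes f_add: "f (x + y) = f x + f y" and f_Rats: "f x \<in> \<rat>"
    and f_vanishes: "x \<in> \<rat> \<Longrightarrow> f x = 0" and f_\<theta>: "f \<theta> = 1"
begin

lemma f_divide: "n \<ge> 1 \<Longrightarrow> f (x / real n) = f x / real n"
proof -
  assume n: "n \<ge> 1"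
  have "f (real k * y) = real k * f y" for k y
    by (induction k) (simp_all add: f_vanishes f_add algebra_simps)
  from this[of n "x / real n"] show ?thesis
    using n by (simp add: field_simps)
qed

text \<open>As \<open>f\<close> vanishes on the rationals, the twist agrees with \<open>frac\<close>
  there and in particular keeps the torsion data.\<close>

definition twist :: "nat set \<Rightarrow> real \<Rightarrow> real" where
  "twist A x = frac (x + profinite_mult A (f x))"

lemma RZ_extension_twist: "RZ_extension real_add_group of_int (twist A)"
proof -
  have std: "RZ_extension real_add_group of_int frac"
    using rz_extension_real by (simp add: rz_extension_def)
  have "twist A (x + y) = twist A x \<otimes>\<^bsub>RZ\<^esub> twist A y" for x y
  proof -
    obtain k where "profinite_mult A (f (x + y)) = profinite_mult A (f x) + profinite_mult A (f y) + of_int k"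
      using profinite_mult_add[OF f_Rats[of x] f_Rats[of y], of A] by (auto simp: f_add)
    then have "x + y + profinite_mult A (f (x + y)) =
        (x + profinite_mult A (f x)) + (y + profinite_mult A (f y)) + of_int k"
      by simp
    then have "twist A (x + y) = frac ((x + profinite_mult A (f x)) + (y + profinite_mult A (f y)))"
      by (simp only: twist_def frac_add_of_int)
    then show ?thesis
      by (simp add: RZ_mult twist_def)
  qed
  moreover have "twist A x \<in> carrier RZ" for x
    by (simp add: twist_def in_carrier_RZ frac_lt_1)
  moreover have "\<exists>x. twist A x = t" if "t \<in> carrier RZ" for t
  proof
    \<comment> \<open>The correction is rational and invisible to \<open>f\<close>, so subtracting
      it inverts the twist.\<close>
    have "f (t - profinite_mult A (f t)) = f t"
      using f_add[of "t - profinite_mult A (f t)" "profinite_mult A (f t)"]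
        f_vanishes[OF profinite_mult_Rats[OF f_Rats]] by simp
    then show "twist A (t - profinite_mult A (f t)) = t"
      using that by (simp add: twist_def in_carrier_RZ frac_eq)
  qed
  ultimately have "twist A \<in> epi real_add_group RZ"
    by (auto simp: epi_def hom_def real_add_group_def image_iff set_eq_iff) metis
  moreover have "twist A x = 0 \<longleftrightarrow> x \<in> \<int>" for x
  proof
    assume "twist A x = 0"
    then have int: "x + profinite_mult A (f x) \<in> \<int>"
      by (simp add: twist_def)
    \<comment> \<open>An integer minus a rational is rational, so \<open>f\<close> vanishes at
      \<open>x\<close> and the twist there is plain reduction.\<close>
    then have "x + profinite_mult A (f x) - profinite_mult A (f x) \<in> \<rat>"
      using Ints_subset_Rats profinite_mult_Rats[OF f_Rats] by (intro Rats_diff) auto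
    then have "f x = 0"
      by (simp add: f_vanishes)
    with int show "x \<in> \<int>"
      by simp
  next
    assume "x \<in> \<int>"
    then have "f x = 0"
      using Ints_subset_Rats by (auto intro: f_vanishes)
    with \<open>x \<in> \<int>\<close> show "twist A x = 0"
      by (simp add: twist_def)
  qed
  then have "kernel real_add_group RZ (twist A) = of_int ` carrier integer_group"
    by (auto simp: kernel_def real_add_group_def Ints_def)
  ultimately show ?thesis
    using std by (simp add: RZ_extension_def)
qed

text \<open>The point matching \<open>\<theta>\<close> must be an integer translate of it. Comparing
  coordinates of index \<open>N!\<close> shows that the two profinite integers differ by a fixed
  integer.\<close>

lemma twist_image_eq_imp_dvd:
  assumes "pi_hat real_add_group (twist A) ` UNIV = pi_hat real_add_group (twist B) ` UNIV"
  obtains m :: int where "\<And>N. fact N dvd int (fact_sum A N) - int (fact_sum B N) - m"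
proof -
  obtain y where y: "pi_hat real_add_group (twist A) \<theta> = pi_hat real_add_group (twist B) y"
    using assms by (auto simp: set_eq_iff image_iff)
  have eq: "twist A (\<theta> / real n) = twist B (y / real n)" if "n \<ge> 1" for n
    using fun_cong[OF y, of n] that by (simp add: pi_hat_def gdiv_real)
  \<comment> \<open>The first coordinate: \<open>f \<theta> = 1\<close> and the profinite multiple
    of 1 vanishes, so the left side reduces to \<open>frac \<theta>\<close>.\<close>
  obtain k where k: "\<theta> = y + profinite_mult B (f y) + of_int k"
    using eq[of 1] by (auto simp: twist_def f_\<theta> profinite_mult_1 frac_eq_frac_iff)
  have "f y = 1"
    using f_add[of y "profinite_mult B (f y) + of_int k"] profinite_mult_Rats[OF f_Rats]
      f_vanishes[of "profinite_mult B (f y) + of_int k"] k f_\<theta> by (simp add: add.assoc)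
  then have y\<theta>: "y = \<theta> - of_int k"
    using k by (simp add: profinite_mult_1)
  show thesis
  proof (rule that[of "- k"])
    fix N
    let ?n = "fact N :: nat"
    have n: "?n \<ge> 1"
      by (simp add: Suc_le_eq)
    have pm: "profinite_mult C (1 / real ?n) = frac (real (fact_sum C N) / real ?n)" for C
      using profinite_mult_eq[of "1 / real ?n" N C] by simp
    have "frac (\<theta> / real ?n + frac (real (fact_sum A N) / real ?n)) =
        frac (y / real ?n + frac (real (fact_sum B N) / real ?n))"
      using eq[OF n] n by (simp add: twist_def f_divide f_\<theta> \<open>f y = 1\<close> pm del: of_nat_fact)
    then obtain j where "\<theta> / real ?n + real (fact_sum A N) / real ?n =
        y / real ?n + real (fact_sum B N) / real ?n + of_int j"
      by (auto simp: frac_eq_frac_iff)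
    then have "(real (fact_sum A N) - real (fact_sum B N) + of_int k) / real ?n = of_int j"
      by (simp add: y\<theta> diff_divide_distrib add_divide_distrib)
    then have "real (fact_sum A N) = real (fact_sum B N) - of_int k + of_int j * real ?n"
      using n by (simp add: divide_eq_eq algebra_simps)
    then have "real_of_int (int (fact_sum A N) - int (fact_sum B N) - (- k)) = of_int (j * int ?n)"
      by simp
    then have "int (fact_sum A N) - int (fact_sum B N) - (- k) = j * fact N"
      by (simp only: of_int_eq_iff of_nat_fact)
    then show "fact N dvd int (fact_sum A N) - int (fact_sum B N) - (- k)"
      by simp
  qed
qed

text \<open>For large \<open>N\<close> the difference of partial sums, less \<open>m\<close>, is
  divisible by \<open>N!\<close> but smaller than it, hence zero. A difference of partial sums that
  is eventually constant means that membership eventually agrees.\<close>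

lemma twist_image_eq_imp_finite:
  assumes "pi_hat real_add_group (twist A) ` UNIV = pi_hat real_add_group (twist B) ` UNIV"
  shows "finite {j. j \<in> A \<longleftrightarrow> j \<notin> B}"
proof -
  obtain m :: int where dvd: "\<And>N. fact N dvd int (fact_sum A N) - int (fact_sum B N) - m"
    using twist_image_eq_imp_dvd[OF assms] by metis
  have diff: "int (fact_sum A N) - int (fact_sum B N) = m" if N: "N \<ge> nat \<bar>m\<bar> + 3" for N
  proof -
    obtain M where M: "N = Suc M"
      using N by (cases N) auto
    let ?d = "int (fact_sum A N) - int (fact_sum B N) - m"
    have "fact_sum A N \<le> 2 * fact M" "fact_sum B N \<le> 2 * fact M"
      using fact_sum_le M by auto
    then have "int (fact_sum A N) \<le> int (2 * fact M)" "int (fact_sum B N) \<le> int (2 * fact M)"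
      by (simp_all only: of_nat_le_iff)
    then have "\<bar>?d\<bar> \<le> 2 * fact M + \<bar>m\<bar>"
      by simp
    \<comment> \<open>The total factor of \<open>fact M\<close> becomes the absolute value of
      \<open>m\<close> plus 3, which is the threshold imposed on \<open>N\<close>.\<close>
    also have "\<dots> < 2 * fact M + (\<bar>m\<bar> + 1) * fact M"
    proof (rule add_strict_left_mono)
      have "\<bar>m\<bar> < (\<bar>m\<bar> + 1) * 1"
        by simp
      also have "\<dots> \<le> (\<bar>m\<bar> + 1) * fact M"
        by (intro mult_left_mono fact_ge_1) simp
      finally show "\<bar>m\<bar> < (\<bar>m\<bar> + 1) * fact M" .
    qed
    also have "\<dots> \<le> int N * fact M"
      using N mult_right_mono[of "\<bar>m\<bar> + 3" "int N" "fact M"] by (simp add: algebra_simps)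
    also have "\<dots> = fact N"
      by (simp add: M)
    finally have "\<bar>?d\<bar> < fact N" .
    then have "?d = 0"
      using dvd[of N] by (metis dvd_imp_le_int fact_ge_zero abs_of_nonneg not_less)
    then show ?thesis by simp
  qed
  \<comment> \<open>Passing from \<open>j\<close> to \<open>Suc j\<close> adds \<open>j!\<close>
    exactly for membership, and the difference must remain \<open>m\<close>.\<close>
  have "j \<in> A \<longleftrightarrow> j \<in> B" if "j \<ge> nat \<bar>m\<bar> + 3" for j
    using diff[OF that] diff[of "Suc j"] that fact_gt_zero[of j, where ?'a = int]
    by (auto simp: fact_sum_Suc split: if_splits)
  then have "{j. j \<in> A \<longleftrightarrow> j \<notin> B} \<subseteq> {..<nat \<bar>m\<bar> + 3}"
    by (auto simp: not_le[symmetric])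
  then show ?thesis
    by (rule finite_subset) simp
qed

end

lemma isomorphic_gen_refl: "ext_structure G \<iota> \<pi> \<cong>\<^sub>\<plusminus> ext_structure G \<iota> \<pi>"
  unfolding L_isomorphic_gen_def
proof (rule bexI[of _ 1])
  show "ext_structure G \<iota> \<pi> \<cong>\<^sub>L (ext_structure G \<iota> \<pi>)\<lparr>gam_one := 1\<rparr>"
    by (rule iso_imp_isomorphic[of id]) (auto simp: iso_def hom_def bij_betw_def)
qed simp

text \<open>Each \<open>A\<close> is coded by a set containing infinitely many copies of every element of \<open>A\<close>, so that
  the codes of different sets differ infinitely often.\<close>

theorem continuum_many_isomorphism_types:
  "(UNIV :: nat set set) \<lesssim> (RZ_structures :: (int, real, real) L_structure set) //
     {(S, S'). S \<in> RZ_structures \<and> S' \<in> RZ_structures \<and> S \<cong>\<^sub>\<plusminus> S'}"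
    (is "_ \<lesssim> _ // ?R")
proof -
  obtain f \<theta> where "rational_functional f \<theta>"
    using rational_functional_exists unfolding rational_functional_def by metis
  then interpret rational_functional f \<theta> .
  define code where "code A = {n. fst (prod_decode n) \<in> A}" for A :: "nat set"
  define S where "S A = ext_structure real_add_group of_int (twist (code A))" for A
  have S: "S A \<in> RZ_structures" for A
    using RZ_extension_twist by (auto simp: RZ_structures_def S_def)
  have "A = B" if "?R `` {S A} = ?R `` {S B}" for A B
  proof -
    have "S B \<in> ?R `` {S B}"
      using S isomorphic_gen_refl by (auto simp: S_def)
    then have "S A \<cong>\<^sub>\<plusminus> S B"
      using that by auto
    then have "pi_hat real_add_group (twist (code A)) ` UNIV = pi_hat real_add_group (twist (code B)) ` UNIV"
      using isomorphic_gen_iff_image_eq[of real_add_group of_int _ real_add_group of_int]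
        RZ_extension_twist by (auto simp: S_def rz_extension_def real_add_group_def)
    then have fin: "finite {j. j \<in> code A \<longleftrightarrow> j \<notin> code B}"
      by (rule twist_image_eq_imp_finite)
    show ?thesis
    proof (rule ccontr)
      assume "A \<noteq> B"
      then obtain a where "a \<in> A \<longleftrightarrow> a \<notin> B"
        by auto
      then have "range (\<lambda>i. prod_encode (a, i)) \<subseteq> {j. j \<in> code A \<longleftrightarrow> j \<notin> code B}"
        by (auto simp: code_def)
      then have "finite (range (\<lambda>i. prod_encode (a, i)))"
        using fin by (rule finite_subset)
      moreover have "inj (\<lambda>i. prod_encode (a, i))"
        by (auto simp: inj_def)
      ultimately show False
        using finite_imageD by blast
    qed
  qed
  then have "inj (\<lambda>A. ?R `` {S A})"
    by (rule injI)
  moreover have "range (\<lambda>A. ?R `` {S A}) \<subseteq> RZ_structures // ?R"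
    using S by (intro image_subsetI quotientI)
  ultimately show ?thesis
    unfolding lepoll_def by blast
qed

theorem theorem3p12:
  fixes G :: "'g monoid" and \<iota> :: "int \<Rightarrow> 'g" and \<pi> :: "'g \<Rightarrow> real"
  assumes "RZ_extension G \<iota> \<pi>"
  shows
    "(ext_structure G \<iota> \<pi> \<equiv>\<^sub>L standard_model \<longleftrightarrow>
        (\<forall>n::nat. n \<ge> 1 \<longrightarrow> \<pi> (gdiv G (\<iota> 1) n) = frac (1 / real n)))
    \<and>
     (\<forall>(H :: 'h monoid) \<kappa> \<rho>. RZ_extension H \<kappa> \<rho> \<longrightarrow>
        (ext_structure G \<iota> \<pi> \<cong>\<^sub>\<plusminus> ext_structure H \<kappa> \<rho> \<longleftrightarrow>
           pi_hat G \<pi> ` carrier G = pi_hat H \<rho> ` carrier H) \<and>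
        (ext_structure G \<iota> \<pi> \<equiv>\<^sub>L standard_model \<and> ext_structure H \<kappa> \<rho> \<equiv>\<^sub>L standard_model \<longrightarrow>
          (ext_structure G \<iota> \<pi> \<cong>\<^sub>L ext_structure H \<kappa> \<rho> \<longleftrightarrow>
             pi_hat G \<pi> ` carrier G = pi_hat H \<rho> ` carrier H)))
    \<and>
     (UNIV :: nat set set) \<lesssim>
        (RZ_structures :: (int, real, real) L_structure set) //
          {(S, S'). S \<in> RZ_structures \<and> S' \<in> RZ_structures \<and> S \<cong>\<^sub>\<plusminus> S'}
    \<and>
     (ext_structure G \<iota> \<pi> \<cong>\<^sub>\<plusminus> standard_model \<longleftrightarrow>
        (\<exists>X. topological_group G X \<and> covering_map X RZ_topology \<pi>)) \<and>
     (ext_structure G \<iota> \<pi> \<equiv>\<^sub>L standard_model \<longrightarrow>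
       (ext_structure G \<iota> \<pi> \<cong>\<^sub>L standard_model \<longleftrightarrow>
          (\<exists>X. topological_group G X \<and> covering_map X RZ_topology \<pi>)))"
  proof -
  interpret G: rz_extension G \<iota> \<pi>
    using assms by (simp add: rz_extension_def)
  have std: "standard_model \<equiv>\<^sub>L standard_model"
    by (simp add: elem_equiv_def)
  have H: "rz_extension H \<kappa> \<rho>" if "RZ_extension H \<kappa> \<rho>" for H :: "'h monoid" and \<kappa> \<rho>
    using that by (simp add: rz_extension_def)
  \<comment> \<open>For a structure elementarily equivalent to the standard model, both notions of
    isomorphism reduce to equality of images, so the covering criterion holds for either.\<close>
  have "ext_structure G \<iota> \<pi> \<cong>\<^sub>L standard_model \<longleftrightarrow> ext_structure G \<iota> \<pi> \<cong>\<^sub>\<plusminus> standard_model"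
    if "ext_structure G \<iota> \<pi> \<equiv>\<^sub>L standard_model"
    using isomorphic_iff_image_eq[OF G.rz_extension_axioms rz_extension_real that]
      isomorphic_gen_iff_image_eq[OF G.rz_extension_axioms rz_extension_real] std
    by (simp add: standard_model_def)
  then show ?thesis
    using G.elem_equiv_standard_iff G.isomorphic_gen_standard_iff_covering
      continuum_many_isomorphism_types
      isomorphic_gen_iff_image_eq[OF G.rz_extension_axioms H]
      isomorphic_iff_image_eq[OF G.rz_extension_axioms H]
    by simp
qed

end
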